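(* Let $n$ be a positive integer, $r,s$ nonnegative integers, and $0<q<1$. Then \[ \int_0^1\cdots\int_0^1\prod_{i=1}^nx_i^r\prod_{1\le i<j\le n}|x_j-x_i|\,d_qx_1\cdots d_qx_n=n!\,q^{(r+1)\binom n2+\binom n3}\frac{[1]_q![2]_q!\cdots[n-1]_q!}{\prod_{i=1}^n[r+i]_q\prod_{1\le i<j\le n}[2r+i+j]_q}, \] \[ \int_0^1\cdots\int_0^1\prod_{i=1}^nx_i^r(1-qx_i)\prod_{1\le i<j\le n}|x_j-x_i|\,d_qx_1\cdots d_qx_n=n!\,q^{(r+1)\binom n2+\binom n3}\frac{[1]_q![2]_q!\cdots[n]_q!\,\big[(n+1)r+\binom{n+1}2\big]_q}{\prod_{i=1}^{n+1}[r+i]_q\prod_{1\le i<j\le n+1}[2r+i+j]_q}, \] \[ \int_0^1\cdots\int_0^1\prod_{i=1}^nx_i^r(qx_i;q)_s\prod_{1\le i<j\le n}|x_j-x_i|^2\,d_qx_1\cdots d_qx_n=n!\,q^{(r+1)\binom n2+2\binom n3}\frac{[1]_q!\cdots[n-1]_q!\,[s+1]_q![s+2]_q!\cdots[s+n-1]_q!}{\prod_{i=1}^{n+s}\prod_{j=1}^n[r+i+j-1]_q}. \]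
   Context: $[a]_q=(1-q^a)/(1-q)$, $[i]_q!=[1]_q\cdots[i]_q$, $(qx;q)_s=\prod_{i=1}^s(1-q^ix)$. The Jackson integral is $\int_{[0,1]^n} f\,d_qx=(1-q)^n\sum_{k_1,\dots,k_n\ge0} f(q^{k_1},\dots,q^{k_n})\,q^{k_1+\cdots+k_n}$.
   Formalization: Two misprints are corrected: in the second formula the factor [(n+1)r+binom(n+1,2)]_q is replaced by [(n+1)r+binom(n+2,2)]_q, and in the third the product [s+1]_q!...[s+n-1]_q! is replaced by [s]_q![s+1]_q!...[s+n-1]_q!. *)

theory Defs
  imports "HOL-Analysis.Analysis"
begin

definition qnum :: "real \<Rightarrow> nat \<Rightarrow> real" where
  "qnum q a = (1 - q ^ a) / (1 - q)"

definition qfact :: "real \<Rightarrow> nat \<Rightarrow> real" where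
  "qfact q m = (\<Prod>i=1..m. qnum q i)"

text \<open>The shifted factorial usually written \<open>(qx; q)\<^sub>s\<close>: the product starts at \<open>i = 1\<close>.\<close>

definition qx_poch :: "real \<Rightarrow> real \<Rightarrow> nat \<Rightarrow> real" where
  "qx_poch q x s = (\<Prod>i=1..s. 1 - q ^ i * x)"

text \<open>
  A point of \<open>[0,1]\<^sup>n\<close> is a function on indices of which only the values at \<open>1, \<dots>, n\<close> matter;
  the multi-indices \<open>(k\<^sub>1, \<dots>, k\<^sub>n)\<close> are the extensional functions on \<open>{1..n}\<close>, so that each
  one is counted once.  As \<^const>\<open>infsum\<close> is \<open>0\<close> on families that are not summable, an equation
  with a nonzero right-hand side includes (absolute) convergence of the series.
\<close>

definition jackson_integral :: "real \<Rightarrow> nat \<Rightarrow> ((nat \<Rightarrow> real) \<Rightarrow> real) \<Rightarrow> real" where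
  "jackson_integral q n f =
     (1 - q) ^ n *
     (\<Sum>\<^sub>\<infinity>k\<in>{1..n} \<rightarrow>\<^sub>E (UNIV :: nat set). f (\<lambda>i. q ^ k i) * q ^ (\<Sum>i=1..n. k i))"

end

theory Submission
  imports Defs "Jordan_Normal_Form.Determinant"
begin

text \<open>
  All three integrals are sums over exponent vectors \<open>k \<in> \<nat>\<^sup>n\<close> of powers of \<open>X\<^sub>i = q\<^bsup>k\<^sub>i\<^esup>\<close>.

  For the first, \<open>\<Prod>\<bar>X\<^sub>j - X\<^sub>i\<bar>\<close> is the sign of the ordering of \<open>k\<close> times a Vandermonde determinant.
  Expanding the determinant leaves \<open>n!\<close> equal copies of
  \<open>T(y) = \<Sum>\<^sub>k \<Prod>\<^sub>i\<^sub><\<^sub>j sgn (k\<^sub>i - k\<^sub>j) \<Prod>\<^sub>i y\<^sub>i\<^bsup>k\<^sub>i\<^esup>\<close> at \<open>y\<^sub>i = q\<^bsup>r+i\<^esup>\<close>, which is Littlewood's sum of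
  all Schur functions.  Splitting off the minimal entry of \<open>k\<close> gives a recursion for \<open>T\<close>, and Lagrange
  interpolation shows that its solution is \<open>\<Prod>\<^sub>i 1/(1 - y\<^sub>i) \<Prod>\<^sub>i\<^sub><\<^sub>j (y\<^sub>i - y\<^sub>j)/(1 - y\<^sub>i y\<^sub>j)\<close>.

  The second integral is the first one in \<open>n + 1\<close> variables after splitting off the minimal entry: the
  factors \<open>1 - q x\<^sub>i\<close> are the differences to the removed variable.

  For the third, both Vandermonde factors are expanded, which yields \<open>n!\<close> times a determinant of
  one-dimensional \<open>q\<close>-beta integrals; after clearing row and column factors it is again of
  Vandermonde type.
\<close>

section \<open>Products over pairs\<close>

text \<open>The index set is arbitrary so that one index can be deleted from a product over pairs,
  as the recursions on the minimal entry require.\<close>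

definition pairprod :: "nat set \<Rightarrow> (nat \<Rightarrow> nat \<Rightarrow> real) \<Rightarrow> real" where
  "pairprod A g = (\<Prod>(i, j)\<in>{(i, j). i \<in> A \<and> j \<in> A \<and> i < j}. g i j)"

lemma finite_pairs: "finite A \<Longrightarrow> finite {(i, j). i \<in> A \<and> j \<in> A \<and> (i::nat) < j}"
  by (rule finite_subset[of _ "A \<times> A"]) auto

lemma pairprod_cong:
  assumes "\<And>i j. i \<in> A \<Longrightarrow> j \<in> A \<Longrightarrow> i < j \<Longrightarrow> g i j = h i j"
  shows "pairprod A g = pairprod A h"
  unfolding pairprod_def by (rule prod.cong) (use assms in auto)

lemma pairprod_empty [simp]: "pairprod {} g = 1"
  by (simp add: pairprod_def)

lemma pairprod_mult: "pairprod A (\<lambda>i j. g i j * h i j) = pairprod A g * pairprod A h"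
  unfolding pairprod_def by (simp add: prod.distrib case_prod_unfold)

lemma pairprod_divide: "pairprod A (\<lambda>i j. g i j / h i j) = pairprod A g / pairprod A h"
  unfolding pairprod_def by (simp add: prod_dividef case_prod_unfold)

lemma pairprod_remove:
  assumes "finite A" "a \<in> A"
  shows "pairprod A g = pairprod (A - {a}) g * (\<Prod>i\<in>A - {a}. if i < a then g i a else g a i)"
proof -
  let ?P = "\<lambda>A. {(i, j). i \<in> A \<and> j \<in> A \<and> (i::nat) < j}"
  let ?h = "\<lambda>i. if i < a then (i, a) else (a, i)"
  have eq: "?P A = ?P (A - {a}) \<union> ?h ` (A - {a})"
    using assms by (auto split: if_splits)
  have inj: "inj_on ?h (A - {a})"
    by (auto simp: inj_on_def split: if_splits)
  have "pairprod A g = pairprod (A - {a}) g * (\<Prod>(i, j)\<in>?h ` (A - {a}). g i j)"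
    unfolding pairprod_def eq
    by (rule prod.union_disjoint) (use assms finite_pairs[of "A - {a}"] in auto)
  also have "(\<Prod>(i, j)\<in>?h ` (A - {a}). g i j) = (\<Prod>i\<in>A - {a}. if i < a then g i a else g a i)"
    by (subst prod.reindex[OF inj]) (simp add: if_distrib o_def cong: if_cong)
  finally show ?thesis .
qed

section \<open>Lagrange interpolation\<close>

text \<open>The sum is the coefficient of degree \<open>card N - 1\<close> in the Lagrange
  interpolant \<open>L\<close> of \<open>p\<close> at the nodes \<open>N\<close>. Having degree
  below \<open>card N\<close>, \<open>p\<close> equals its interpolant, and its own degree is too
  small for that coefficient to survive.\<close>

lemma sum_lagrange_eq_0:
  fixes p :: "'a::field poly"
  assumes "finite N" and deg: "degree p + 1 < card N"
  shows "(\<Sum>y\<in>N. poly p y / (\<Prod>z\<in>N - {y}. y - z)) = 0"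
proof -
  let ?w = "\<lambda>y. \<Prod>z\<in>N - {y}. y - z"
  let ?B = "\<lambda>y. \<Prod>z\<in>N - {y}. [:- z, 1:]"
  define L where "L = (\<Sum>y\<in>N. Polynomial.smult (poly p y / ?w y) (?B y))"
  have degB: "degree (?B y) = card N - 1" if "y \<in> N" for y
    using that assms(1) by (subst degree_prod_sum_eq) auto
  have coeffB: "coeff (?B y) (card N - 1) = 1" if "y \<in> N" for y
    using lead_coeff_prod[of "\<lambda>z. [:- z, 1:]" "N - {y}"] degB[OF that] by simp
  have "degree L \<le> card N - 1"
    unfolding L_def
    by (rule degree_sum_le) (use assms(1) degB in \<open>auto intro: order.trans[OF degree_smult_le]\<close>)
  then have degL: "degree (p - L) < card N"
    using deg degree_diff_le_max[of p L] by linarith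
  have root: "poly (p - L) u = 0" if "u \<in> N" for u
  proof -
    have "poly L u = (\<Sum>y\<in>N. if y = u then poly p u else 0)"
      unfolding L_def poly_sum
    proof (rule sum.cong[OF refl])
      fix y assume y: "y \<in> N"
      show "poly (Polynomial.smult (poly p y / ?w y) (?B y)) u = (if y = u then poly p u else 0)"
      proof (cases "y = u")
        case True
        have "(\<Prod>z\<in>N - {u}. u - z) \<noteq> 0"
          using assms(1) by auto
        with True show ?thesis by (simp add: poly_prod)
      next
        case False
        with that assms(1) show ?thesis by (auto simp: poly_prod)
      qed
    qed
    with that assms(1) show ?thesis by simp
  qed
  have "p - L = 0"
  proof (rule ccontr)
    assume "p - L \<noteq> 0"
    then have "card {u. poly (p - L) u = 0} \<le> degree (p - L)" "finite {u. poly (p - L) u = 0}"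
      by (rule card_poly_roots_bound, rule poly_roots_finite)
    moreover have "card N \<le> card {u. poly (p - L) u = 0}"
      by (rule card_mono) (use root calculation in auto)
    ultimately show False using degL by linarith
  qed
  then have "coeff L (card N - 1) = 0"
    using deg coeff_eq_0[of p "card N - 1"] by auto
  moreover have "coeff L (card N - 1) = (\<Sum>y\<in>N. poly p y / ?w y)"
    unfolding L_def coeff_sum by (rule sum.cong) (use coeffB in simp_all)
  ultimately show ?thesis by simp
qed

text \<open>Lagrange interpolation of \<open>\<Prod>j. 1 - x\<^sub>j z\<close> at the nodes \<open>0\<close>, \<open>-1\<close> and the \<open>x\<^sub>j\<close>.\<close>

lemma sum_prod_lagrange_one_minus_prod:
  fixes x :: "'i \<Rightarrow> real"
  assumes fin: "finite A" and inj: "inj_on x A" and pos: "\<And>i. i \<in> A \<Longrightarrow> 0 < x i"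
  shows "(\<Sum>a\<in>A. (1 - x a) * (\<Prod>j\<in>A - {a}. x j * (1 - x a * x j) / (x j - x a))) = 1 - (\<Prod>i\<in>A. x i)"
proof -
  define p where "p = (\<Prod>j\<in>A. [:1, - x j:])"
  \<comment> \<open>The node -1 makes up the count: \<open>p\<close> has degree at most
    \<open>card A\<close>, so the vanishing sum needs \<open>card A + 2\<close> nodes. They are
    distinct because \<open>x\<close> is injective and positive on \<open>A\<close>.\<close>
  let ?N = "insert 0 (insert (-1) (x ` A))"
  let ?g = "\<lambda>y. poly p y / (\<Prod>z\<in>?N - {y}. y - z)"
  have nz: "0 \<notin> x ` A" "-1 \<notin> x ` A"
    using pos by force+
  have p: "poly p y = (\<Prod>j\<in>A. 1 - x j * y)" for y
    unfolding p_def poly_prod by (simp add: mult.commute[of y])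
  have "degree p \<le> (\<Sum>j\<in>A. degree [:1, - x j:])"
    unfolding p_def using degree_prod_sum_le[OF fin, of "\<lambda>j. [:1, - x j:]"] by (simp add: o_def)
  also have "\<dots> \<le> (\<Sum>j\<in>A. 1)" by (rule sum_mono) auto
  finally have "degree p + 1 < card ?N"
    using nz fin inj by (simp add: card_image)
  then have "0 = (\<Sum>y\<in>?N. ?g y)"
    using fin by (intro sum_lagrange_eq_0[symmetric]) auto
  also have "\<dots> = ?g 0 + (?g (-1) + (\<Sum>a\<in>A. ?g (x a)))"
    using fin nz by (simp add: sum.reindex[OF inj])
  finally have sum0: "?g 0 + (?g (-1) + (\<Sum>a\<in>A. ?g (x a))) = 0" by simp
  \<comment> \<open>\<open>?s\<close> is the denominator of the term at the node 0, where
    \<open>p\<close> has the value 1. Scaling by it turns the terms at 0 and -1 into 1 and minus the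
    product of the \<open>x i\<close>.\<close>
  let ?s = "\<Prod>j\<in>A. - x j"
  have nzs: "?s \<noteq> 0" using fin pos by force
  have g0: "?s * ?g 0 = 1"
  proof -
    have "?N - {0} = insert (-1) (x ` A)" using nz by force
    then show ?thesis using fin nz nzs by (simp add: p prod.reindex[OF inj])
  qed
  have g1: "?s * ?g (-1) = - (\<Prod>i\<in>A. x i)"
  proof -
    have "?N - {-1} = insert 0 (x ` A)" using nz by force
    then have "?g (-1) = (\<Prod>j\<in>A. 1 + x j) / (- (\<Prod>j\<in>A. - 1 - x j))"
      using fin nz by (simp add: p prod.reindex[OF inj])
    also have "(\<Prod>j\<in>A. - 1 - x j) = (\<Prod>j\<in>A. - 1) * (\<Prod>j\<in>A. 1 + x j)"
      by (subst prod.distrib[symmetric]) simp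
    finally have "?g (-1) = - (1 / (\<Prod>j\<in>A. - 1))"
      using prod_pos[of A "\<lambda>j. 1 + x j"] pos by (simp add: add_pos_pos less_imp_neq[symmetric])
    moreover have "?s = (\<Prod>j\<in>A. - 1) * (\<Prod>j\<in>A. x j)"
      by (subst prod.distrib[symmetric]) simp
    ultimately show ?thesis by simp
  qed
  have gx: "?s * ?g (x a) = - ((1 - x a) * (\<Prod>j\<in>A - {a}. x j * (1 - x a * x j) / (x j - x a)))"
    if a: "a \<in> A" for a
  proof -
    have "?N - {x a} = insert 0 (insert (-1) (x ` (A - {a})))"
      using nz a inj by (auto simp: inj_on_def)
    moreover have "inj_on x (A - {a})" using inj by (rule inj_on_subset) auto
    moreover have "0 \<notin> x ` (A - {a})" "-1 \<notin> x ` (A - {a})" using nz by auto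
    ultimately have "?g (x a) = (\<Prod>j\<in>A. 1 - x j * x a) / (x a * ((x a + 1) * (\<Prod>j\<in>A - {a}. x a - x j)))"
      using fin by (simp add: p prod.reindex)
    \<comment> \<open>The numerator factor with \<open>j = a\<close> is
      \<open>1 - x a * x a\<close>; its part \<open>1 + x a\<close> cancels against the distance
      from \<open>x a\<close> to the node -1.\<close>
    also have "\<dots> = (1 - x a) / x a * (\<Prod>j\<in>A - {a}. (1 - x j * x a) / (x a - x j))"
    proof -
      have "1 - x a * x a = (1 - x a) * (x a + 1)" by (simp add: algebra_simps)
      moreover have "x a + 1 \<noteq> 0" using pos[OF a] by simp
      ultimately show ?thesis
        using fin a by (simp add: prod.remove[of A a] prod_dividef)
    qed
    also have "?s * \<dots> = - (1 - x a) * ((\<Prod>j\<in>A - {a}. - x j) * (\<Prod>j\<in>A - {a}. (1 - x j * x a) / (x a - x j)))"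
      using pos[OF a] by (simp add: prod.remove[OF fin a]) (simp add: algebra_simps)
    also have "(\<Prod>j\<in>A - {a}. - x j) * (\<Prod>j\<in>A - {a}. (1 - x j * x a) / (x a - x j)) =
        (\<Prod>j\<in>A - {a}. x j * (1 - x a * x j) / (x j - x a))"
      unfolding prod.distrib[symmetric]
    proof (rule prod.cong[OF refl])
      fix j assume "j \<in> A - {a}"
      then have "x a - x j \<noteq> 0" "x j - x a \<noteq> 0" using inj a by (auto simp: inj_on_def)
      then show "- x j * ((1 - x j * x a) / (x a - x j)) = x j * (1 - x a * x j) / (x j - x a)"
        by (simp add: field_simps)
    qed
    finally show ?thesis by (simp only: mult_minus_left)
  qed
  have sx: "(\<Sum>a\<in>A. ?s * ?g (x a)) =
      (\<Sum>a\<in>A. - ((1 - x a) * (\<Prod>j\<in>A - {a}. x j * (1 - x a * x j) / (x j - x a))))"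
    by (rule sum.cong[OF refl gx])
  have "?s * (?g 0 + (?g (-1) + (\<Sum>a\<in>A. ?g (x a)))) =
      1 - (\<Prod>i\<in>A. x i) - (\<Sum>a\<in>A. (1 - x a) * (\<Prod>j\<in>A - {a}. x j * (1 - x a * x j) / (x j - x a)))"
    unfolding distrib_left g0 g1 sum_distrib_left sx by (simp add: sum_negf)
  then show ?thesis unfolding sum0 by simp
qed

section \<open>Signed sums over exponent vectors\<close>

text \<open>Without summability \<open>infsum\<close> would be 0 by convention, whereas the product
  formula for \<open>infsum\<close> gives the product of the geometric sums
  \<open>1 / (1 - x i)\<close>, which is nonzero.\<close>

lemma summable_on_PiE_prod_power:
  fixes x :: "'i \<Rightarrow> real"
  assumes "finite A" "\<And>i. i \<in> A \<Longrightarrow> 0 \<le> x i" "\<And>i. i \<in> A \<Longrightarrow> x i < 1"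
  shows "(\<lambda>m. \<Prod>i\<in>A. x i ^ m i) summable_on (A \<rightarrow>\<^sub>E (UNIV :: nat set))"
proof (rule ccontr)
  assume "\<not> ?thesis"
  then have "infsum (\<lambda>m. \<Prod>i\<in>A. x i ^ m i) (A \<rightarrow>\<^sub>E (UNIV :: nat set)) = 0"
    by (rule infsum_not_exists)
  moreover have hs: "((\<lambda>k. x i ^ k) has_sum (1 / (1 - x i))) (UNIV :: nat set)" if "i \<in> A" for i
    using assms that by (intro norm_summable_imp_has_sum geometric_sums) (auto simp: summable_geometric)
  have "infsum (\<lambda>m. \<Prod>i\<in>A. x i ^ m i) (A \<rightarrow>\<^sub>E (UNIV :: nat set)) = (\<Prod>i\<in>A. infsum (\<lambda>k. x i ^ k) UNIV)"
  proof (rule infsum_prod_PiE_abs[OF assms(1)])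
    fix i assume i: "i \<in> A"
    then show "(\<lambda>k. norm (x i ^ k)) summable_on (UNIV :: nat set)"
      using hs[OF i] assms by (auto simp: summable_on_def)
  qed
  also have "\<dots> = (\<Prod>i\<in>A. 1 / (1 - x i))"
    by (rule prod.cong) (auto intro: infsumI hs)
  also have "\<dots> \<noteq> 0" using assms by force
  ultimately show False by simp
qed

lemma summable_on_PiE_bounded:
  fixes x :: "'i \<Rightarrow> real" and f :: "('i \<Rightarrow> nat) \<Rightarrow> real"
  assumes "finite A" "\<And>i. i \<in> A \<Longrightarrow> 0 \<le> x i" "\<And>i. i \<in> A \<Longrightarrow> x i < 1"
    and "\<And>m. m \<in> A \<rightarrow>\<^sub>E UNIV \<Longrightarrow> \<bar>f m\<bar> \<le> (\<Prod>i\<in>A. x i ^ m i)"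
  shows "f summable_on (A \<rightarrow>\<^sub>E UNIV)"
proof -
  have "(\<lambda>m. norm (f m)) summable_on (A \<rightarrow>\<^sub>E UNIV)"
    by (rule summable_on_comparison_test[OF summable_on_PiE_prod_power[OF assms(1-3)]]) (use assms(4) in auto)
  then show ?thesis by (rule abs_summable_summable)
qed

section \<open>Splitting off the minimal entry of an exponent vector\<close>

lemma infsum_Times_mult:
  fixes g :: "'a \<Rightarrow> real" and h :: "'b \<Rightarrow> real"
  assumes "(\<lambda>(x, y). g x * h y) summable_on A \<times> B"
  shows "infsum (\<lambda>(x, y). g x * h y) (A \<times> B) = infsum g A * infsum h B"
proof -
  have "infsum (\<lambda>(x, y). g x * h y) (A \<times> B) = (\<Sum>\<^sub>\<infinity>x\<in>A. \<Sum>\<^sub>\<infinity>y\<in>B. g x * h y)"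
    using infsum_Sigma_banach[OF assms] by simp
  then show ?thesis by (simp add: infsum_cmult_left' infsum_cmult_right')
qed

text \<open>Every exponent vector with distinct entries arises exactly once by choosing the position \<open>a\<close>
  and the value \<open>c\<close> of its minimum.\<close>

definition insert_min :: "nat set \<Rightarrow> nat \<Rightarrow> nat \<Rightarrow> (nat \<Rightarrow> nat) \<Rightarrow> (nat \<Rightarrow> nat)" where
  "insert_min A a c m = (\<lambda>j\<in>A. if j = a then c else c + 1 + m j)"

lemma insert_min_at:
  "a \<in> A \<Longrightarrow> insert_min A a c m a = c" "j \<in> A - {a} \<Longrightarrow> insert_min A a c m j = c + 1 + m j"
  by (auto simp: insert_min_def)

lemma bij_betw_insert_min:
  assumes "a \<in> A"
  shows "bij_betw (\<lambda>(c, m). insert_min A a c m) (UNIV \<times> ((A - {a}) \<rightarrow>\<^sub>E UNIV))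
           {m \<in> A \<rightarrow>\<^sub>E UNIV. \<forall>j\<in>A - {a}. m a < m j}"
\<comment> \<open>The inverse subtracts \<open>m a + 1\<close> from every other entry; truncated
  subtraction loses nothing because \<open>m a < m j\<close>.\<close>
proof (rule bij_betwI[where g = "\<lambda>m. (m a, \<lambda>j\<in>A - {a}. m j - m a - 1)"])
  show "(\<lambda>(c, m). insert_min A a c m) \<in> UNIV \<times> ((A - {a}) \<rightarrow>\<^sub>E UNIV) \<rightarrow>
      {m \<in> A \<rightarrow>\<^sub>E UNIV. \<forall>j\<in>A - {a}. m a < m j}"
  proof (clarsimp, intro conjI ballI)
    fix c :: nat and m :: "nat \<Rightarrow> nat"
    show "insert_min A a c m \<in> A \<rightarrow>\<^sub>E UNIV"
      unfolding insert_min_def by (rule restrict_PiE_iff[THEN iffD2]) simp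
    fix j assume "j \<in> A - {a}"
    then show "insert_min A a c m a < insert_min A a c m j"
      using assms by (simp add: insert_min_def)
  qed
  show "(\<lambda>m. (m a, \<lambda>j\<in>A - {a}. m j - m a - 1)) \<in>
      {m \<in> A \<rightarrow>\<^sub>E UNIV. \<forall>j\<in>A - {a}. m a < m j} \<rightarrow> UNIV \<times> ((A - {a}) \<rightarrow>\<^sub>E UNIV)"
    by (intro funcsetI) (simp add: restrict_PiE_iff)
next
  fix z :: "nat \<times> (nat \<Rightarrow> nat)" assume "z \<in> UNIV \<times> ((A - {a}) \<rightarrow>\<^sub>E UNIV)"
  then obtain c m where z: "z = (c, m)" and m: "m \<in> (A - {a}) \<rightarrow>\<^sub>E UNIV" by blast
  have "(\<lambda>j\<in>A - {a}. insert_min A a c m j - insert_min A a c m a - 1) = m"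
    using assms m by (intro PiE_ext[OF _ m]) (simp_all add: insert_min_def restrict_PiE_iff)
  then show "(\<lambda>m. (m a, \<lambda>j\<in>A - {a}. m j - m a - 1)) ((\<lambda>(c, m). insert_min A a c m) z) = z"
    using assms by (simp add: z insert_min_at)
next
  fix m :: "nat \<Rightarrow> nat" assume m: "m \<in> {m \<in> A \<rightarrow>\<^sub>E UNIV. \<forall>j\<in>A - {a}. m a < m j}"
  have "insert_min A a (m a) (\<lambda>j\<in>A - {a}. m j - m a - 1) j = m j" for j
  proof -
    consider "j = a" | "j \<in> A - {a}" | "j \<notin> A" by auto
    then show ?thesis
    proof cases
      case 2
      with m have "m a < m j" by blast
      with 2 show ?thesis by (simp add: insert_min_def)
    qed (use m assms in \<open>auto simp: insert_min_def PiE_iff extensional_def\<close>)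
  qed
  then show "(\<lambda>(c, m). insert_min A a c m) (m a, \<lambda>j\<in>A - {a}. m j - m a - 1) = m"
    by auto
qed

text \<open>An injective vector attains its minimum at exactly one index, so the disjoint sets
  \<open>?S a\<close> cover all injective vectors, and \<open>f\<close> vanishes on whatever they
  miss.\<close>

lemma infsum_PiE_by_argmin:
  fixes f :: "(nat \<Rightarrow> nat) \<Rightarrow> real"
  assumes "finite A" "A \<noteq> {}" and f: "f summable_on (A \<rightarrow>\<^sub>E UNIV)"
    and zero: "\<And>m. m \<in> A \<rightarrow>\<^sub>E UNIV \<Longrightarrow> \<not> inj_on m A \<Longrightarrow> f m = 0"
  shows "infsum f (A \<rightarrow>\<^sub>E UNIV) =
    (\<Sum>a\<in>A. infsum (\<lambda>(c, m). f (insert_min A a c m)) (UNIV \<times> ((A - {a}) \<rightarrow>\<^sub>E UNIV)))"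
    and "\<And>a. a \<in> A \<Longrightarrow> (\<lambda>(c, m). f (insert_min A a c m)) summable_on (UNIV \<times> ((A - {a}) \<rightarrow>\<^sub>E UNIV))"
proof -
  let ?S = "\<lambda>a. {m \<in> A \<rightarrow>\<^sub>E (UNIV :: nat set). \<forall>j\<in>A - {a}. m a < m j}"
  have sum: "f summable_on ?S a" for a
    by (rule summable_on_subset_banach[OF f]) auto
  show "(\<lambda>(c, m). f (insert_min A a c m)) summable_on (UNIV \<times> ((A - {a}) \<rightarrow>\<^sub>E UNIV))" if "a \<in> A" for a
    using summable_on_reindex_bij_betw[OF bij_betw_insert_min[OF that], of f] sum
    by (simp add: case_prod_unfold)
  have cover: "m \<in> (\<Union>a\<in>A. ?S a)" if m: "m \<in> A \<rightarrow>\<^sub>E UNIV" and inj: "inj_on m A" for m :: "nat \<Rightarrow> nat"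
  proof -
    have "Min (m ` A) \<in> m ` A" using assms by (intro Min_in) auto
    then obtain a where a: "a \<in> A" "m a = Min (m ` A)" by auto
    have "m a < m j" if "j \<in> A - {a}" for j
    proof -
      have "m a \<le> m j" using that a assms(1) by auto
      moreover have "m a \<noteq> m j" using that a inj by (auto simp: inj_on_def)
      ultimately show ?thesis by simp
    qed
    with a m show ?thesis by blast
  qed
  have "infsum f (A \<rightarrow>\<^sub>E UNIV) = infsum f (\<Union>a\<in>A. ?S a)"
  proof (rule infsum_cong_neutral)
    show "f m = 0" if "m \<in> (A \<rightarrow>\<^sub>E UNIV) - (\<Union>a\<in>A. ?S a)" for m
      using that cover[of m] zero[of m] by blast
  qed auto
  also have "\<dots> = (\<Sum>a\<in>A. infsum f (?S a))"
  proof (rule sum_infsum[symmetric])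
    show "?S a \<inter> ?S b = {}" if "a \<in> A" "b \<in> A" "a \<noteq> b" for a b
    proof -
      have False if "m \<in> ?S a" "m \<in> ?S b" for m
      proof -
        have "m a < m b" "m b < m a" using that \<open>a \<in> A\<close> \<open>b \<in> A\<close> \<open>a \<noteq> b\<close> by auto
        then show False by simp
      qed
      then show ?thesis by blast
    qed
  qed (use assms(1) sum in auto)
  also have "\<dots> = (\<Sum>a\<in>A. infsum (\<lambda>(c, m). f (insert_min A a c m)) (UNIV \<times> ((A - {a}) \<rightarrow>\<^sub>E UNIV)))"
  proof (rule sum.cong[OF refl])
    fix a assume "a \<in> A"
    from infsum_reindex_bij_betw[OF bij_betw_insert_min[OF this], of f]
    show "infsum f (?S a) = infsum (\<lambda>(c, m). f (insert_min A a c m)) (UNIV \<times> ((A - {a}) \<rightarrow>\<^sub>E UNIV))"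
      by (simp add: case_prod_unfold)
  qed
  finally show "infsum f (A \<rightarrow>\<^sub>E UNIV) =
    (\<Sum>a\<in>A. infsum (\<lambda>(c, m). f (insert_min A a c m)) (UNIV \<times> ((A - {a}) \<rightarrow>\<^sub>E UNIV)))" .
qed

text \<open>For finite \<open>A\<close> this is the sign of the permutation that sorts
  \<open>m\<close> into decreasing order, and 0 if two entries agree. The value 0 allows sums over
  all exponent vectors.\<close>

definition order_sign :: "nat set \<Rightarrow> (nat \<Rightarrow> nat) \<Rightarrow> real" where
  "order_sign A m = pairprod A (\<lambda>i j. sgn (real (m i) - real (m j)))"

lemma abs_order_sign_le_1: "\<bar>order_sign A m\<bar> \<le> 1"
  unfolding order_sign_def pairprod_def abs_prod
  by (rule prod_le_1) (auto simp: sgn_if)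

lemma pairprod_eq_0_if_not_inj:
  assumes "finite A" "\<not> inj_on f A" "\<And>i j. i \<in> A \<Longrightarrow> j \<in> A \<Longrightarrow> f i = f j \<Longrightarrow> g i j = 0"
  shows "pairprod A g = 0"
proof -
  obtain i j where ij: "i \<in> A" "j \<in> A" "i < j" "f i = f j"
    using assms(2) unfolding inj_on_def by (metis linorder_neqE_nat)
  then have "g i j = 0" using assms(3) by blast
  with ij show ?thesis
    unfolding pairprod_def using finite_pairs[OF assms(1)] by (auto intro!: prod_zero bexI[of _ "(i, j)"])
qed

text \<open>A minimum at \<open>a\<close> contributes -1 for each index to the right of
  \<open>a\<close> and 1 for each index to the left. The common shift by \<open>c + 1\<close> leaves
  all other comparisons unchanged.\<close>

lemma order_sign_insert_min:
  assumes "finite A" "a \<in> A"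
  shows "order_sign A (insert_min A a c m) = order_sign (A - {a}) m * (\<Prod>i\<in>A - {a}. if i < a then 1 else - 1)"
proof -
  have "pairprod (A - {a}) (\<lambda>i j. sgn (real (insert_min A a c m i) - real (insert_min A a c m j))) =
      order_sign (A - {a}) m"
    unfolding order_sign_def by (rule pairprod_cong) (simp add: insert_min_at)
  moreover have "(\<Prod>i\<in>A - {a}. if i < a then sgn (real (insert_min A a c m i) - real (insert_min A a c m a))
        else sgn (real (insert_min A a c m a) - real (insert_min A a c m i))) =
      (\<Prod>i\<in>A - {a}. if i < a then 1 else - 1)"
    by (rule prod.cong) (use assms in \<open>auto simp: insert_min_at\<close>)
  ultimately show ?thesis
    using pairprod_remove[OF assms] by (simp add: order_sign_def)
qed

lemma prod_power_insert_min:
  fixes x :: "nat \<Rightarrow> real"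
  assumes "finite A" "a \<in> A"
  shows "(\<Prod>i\<in>A. x i ^ insert_min A a c m i) =
    (\<Prod>i\<in>A. x i) ^ c * ((\<Prod>i\<in>A - {a}. x i) * (\<Prod>i\<in>A - {a}. x i ^ m i))"
proof -
  have "(\<Prod>i\<in>A - {a}. x i ^ insert_min A a c m i) = (\<Prod>i\<in>A - {a}. x i ^ c * (x i * x i ^ m i))"
    by (rule prod.cong) (auto simp: insert_min_at power_add)
  then show ?thesis
    by (simp add: prod.remove[OF assms] insert_min_at assms prod.distrib prod_power_distrib power_mult_distrib)
qed

lemma infsum_geometric:
  fixes x :: real
  assumes "0 \<le> x" "x < 1"
  shows "infsum (\<lambda>k. x ^ k) (UNIV :: nat set) = 1 / (1 - x)"
  using assms by (intro infsumI norm_summable_imp_has_sum geometric_sums) (auto simp: summable_geometric)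

text \<open>Schur's summation of all Schur functions, with the alternants unfolded into a signed sum
  over all exponent vectors.\<close>

lemma infsum_order_sign:
  fixes x :: "nat \<Rightarrow> real"
  assumes "finite A" "inj_on x A" "\<And>i. i \<in> A \<Longrightarrow> 0 < x i" "\<And>i. i \<in> A \<Longrightarrow> x i < 1"
  shows "infsum (\<lambda>m. order_sign A m * (\<Prod>i\<in>A. x i ^ m i)) (A \<rightarrow>\<^sub>E UNIV) =
    (\<Prod>i\<in>A. 1 / (1 - x i)) * pairprod A (\<lambda>i j. (x i - x j) / (1 - x i * x j))"
  using assms
proof (induction A rule: finite_psubset_induct)
  case (psubset A)
  let ?T = "\<lambda>A. infsum (\<lambda>m. order_sign A m * (\<Prod>i\<in>A. x i ^ m i)) (A \<rightarrow>\<^sub>E UNIV)"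
  let ?C = "\<lambda>A. (\<Prod>i\<in>A. 1 / (1 - x i)) * pairprod A (\<lambda>i j. (x i - x j) / (1 - x i * x j))"
  let ?s = "\<lambda>a. \<Prod>i\<in>A - {a}. if i < a then 1 else - 1 :: real"
  show ?case
  proof (cases "A = {}")
    case True
    then show ?thesis by (simp add: order_sign_def)
  next
    case False
    let ?f = "\<lambda>m. order_sign A m * (\<Prod>i\<in>A. x i ^ m i)"
    let ?X = "\<Prod>i\<in>A. x i"
    have X: "0 \<le> ?X" "?X < 1"
    proof -
      show "0 \<le> ?X" by (rule prod_nonneg) (use psubset.prems in \<open>auto intro: less_imp_le\<close>)
      obtain a where a: "a \<in> A" using False by blast
      have "(\<Prod>i\<in>A - {a}. x i) \<le> 1"
        by (rule prod_le_1) (use psubset.prems in \<open>auto intro: less_imp_le\<close>)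
      then have "?X \<le> x a"
        using psubset.prems(2)[OF a] by (simp add: prod.remove[OF psubset.hyps a] mult_left_le)
      then show "?X < 1" using psubset.prems(3)[OF a] by simp
    qed
    have pw: "0 \<le> (\<Prod>i\<in>A. x i ^ m i)" for m
      by (rule prod_nonneg) (use psubset.prems in \<open>auto intro: less_imp_le\<close>)
    have sum: "?f summable_on (A \<rightarrow>\<^sub>E UNIV)"
    proof (rule summable_on_PiE_bounded[OF psubset.hyps])
      show "\<bar>?f m\<bar> \<le> (\<Prod>i\<in>A. x i ^ m i)" for m
        using pw[of m] abs_order_sign_le_1[of A m] by (simp add: abs_mult mult_left_le_one_le)
    qed (use psubset.prems in \<open>auto intro: less_imp_le\<close>)
    have zero: "?f m = 0" if "\<not> inj_on m A" for m
      using pairprod_eq_0_if_not_inj[OF psubset.hyps that] by (simp add: order_sign_def)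
    have f: "?f (insert_min A a c m) = ?X ^ c * ((?s a * (\<Prod>i\<in>A - {a}. x i)) *
        (order_sign (A - {a}) m * (\<Prod>i\<in>A - {a}. x i ^ m i)))" if "a \<in> A" for a c m
      by (simp add: order_sign_insert_min prod_power_insert_min psubset.hyps that)
    \<comment> \<open>For a fixed position \<open>a\<close> the double sum factors: \<open>c\<close>
      gives a geometric series of ratio \<open>?X\<close>, and \<open>m\<close> gives the sum over
      \<open>A - {a}\<close>, known by induction.\<close>
    have term_eq: "infsum (\<lambda>(c, m). ?f (insert_min A a c m)) (UNIV \<times> ((A - {a}) \<rightarrow>\<^sub>E UNIV)) =
        ?C A / (1 - ?X) * ((1 - x a) * (\<Prod>j\<in>A - {a}. x j * (1 - x a * x j) / (x j - x a)))"
      if a: "a \<in> A" for a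
    proof -
      have IH: "?T (A - {a}) = ?C (A - {a})"
        using a psubset.prems by (intro psubset.IH) (auto intro: inj_on_subset)
      have "infsum (\<lambda>(c, m). ?f (insert_min A a c m)) (UNIV \<times> ((A - {a}) \<rightarrow>\<^sub>E UNIV)) =
          infsum (\<lambda>c. ?X ^ c) UNIV * infsum (\<lambda>m. (?s a * (\<Prod>i\<in>A - {a}. x i)) *
            (order_sign (A - {a}) m * (\<Prod>i\<in>A - {a}. x i ^ m i))) ((A - {a}) \<rightarrow>\<^sub>E UNIV)"
        using infsum_PiE_by_argmin(2)[OF psubset.hyps False sum zero a]
        unfolding f[OF a] by (rule infsum_Times_mult)
      also have "\<dots> = 1 / (1 - ?X) * (?s a * (\<Prod>i\<in>A - {a}. x i) * ?C (A - {a}))"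
        by (simp add: infsum_geometric X infsum_cmult_right' IH)
      also have "?s a * (\<Prod>i\<in>A - {a}. x i) * ?C (A - {a}) =
          ?C A * ((1 - x a) * (\<Prod>j\<in>A - {a}. x j * (1 - x a * x j) / (x j - x a)))"
      proof -
        let ?P = "\<Prod>j\<in>A - {a}. (x j - x a) / (1 - x a * x j)"
        let ?Q = "\<Prod>j\<in>A - {a}. (1 - x a * x j) / (x j - x a)"
        \<comment> \<open>The factors of the closed form that involve \<open>a\<close> carry the
          same sign \<open>?s a\<close> that \<open>order_sign\<close> produces when the minimum is
          removed.\<close>
        have "(\<Prod>i\<in>A - {a}. if i < a then (x i - x a) / (1 - x i * x a) else (x a - x i) / (1 - x a * x i)) =
            ?s a * ?P"
          unfolding prod.distrib[symmetric]
          by (rule prod.cong) (auto simp: mult.commute minus_divide_left)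
        then have CA: "?C A = 1 / (1 - x a) * (\<Prod>i\<in>A - {a}. 1 / (1 - x i)) *
            (pairprod (A - {a}) (\<lambda>i j. (x i - x j) / (1 - x i * x j)) * (?s a * ?P))"
          by (simp add: pairprod_remove[OF psubset.hyps a] prod.remove[OF psubset.hyps a])
        have "?P * ?Q = (\<Prod>j\<in>A - {a}. 1)"
          unfolding prod.distrib[symmetric]
        proof (rule prod.cong[OF refl])
          fix j assume j: "j \<in> A - {a}"
          have "x a * x j < 1 * 1"
            by (rule mult_strict_mono) (use psubset.prems a j in \<open>auto intro: less_imp_le\<close>)
          moreover have "x j \<noteq> x a" using psubset.prems(1) a j by (auto simp: inj_on_def)
          ultimately show "(x j - x a) / (1 - x a * x j) * ((1 - x a * x j) / (x j - x a)) = 1"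
            by simp
        qed
        then have PQ: "?P * ?Q = 1" by simp
        have xa: "1 / (1 - x a) * (1 - x a) = 1" using psubset.prems(3)[OF a] by simp
        have split: "(\<Prod>j\<in>A - {a}. x j * (1 - x a * x j) / (x j - x a)) = (\<Prod>j\<in>A - {a}. x j) * ?Q"
          unfolding prod.distrib[symmetric] by (rule prod.cong) auto
        have "?C A * ((1 - x a) * ((\<Prod>j\<in>A - {a}. x j) * ?Q)) =
            ?s a * (\<Prod>i\<in>A - {a}. x i) * ?C (A - {a}) * (?P * ?Q) * (1 / (1 - x a) * (1 - x a))"
          unfolding CA by (simp only: mult_ac)
        then show ?thesis unfolding split PQ xa mult_1_right by (rule sym)
      qed
      finally show ?thesis by simp
    qed
    have "?T A = (\<Sum>a\<in>A. infsum (\<lambda>(c, m). ?f (insert_min A a c m)) (UNIV \<times> ((A - {a}) \<rightarrow>\<^sub>E UNIV)))"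
      by (rule infsum_PiE_by_argmin(1)[OF psubset.hyps False sum zero])
    also have "\<dots> = (\<Sum>a\<in>A. ?C A / (1 - ?X) * ((1 - x a) * (\<Prod>j\<in>A - {a}. x j * (1 - x a * x j) / (x j - x a))))"
      by (rule sum.cong[OF refl term_eq])
    \<comment> \<open>The interpolation identity evaluates the sum over \<open>a\<close> to
      \<open>1 - ?X\<close>, which cancels the geometric series in \<open>c\<close>.\<close>
    also have "\<dots> = ?C A / (1 - ?X) * (1 - ?X)"
      unfolding sum_distrib_left[symmetric]
      using sum_prod_lagrange_one_minus_prod[OF psubset.hyps psubset.prems(1,2)] by simp
    finally show ?thesis using X by simp
  qed
qed

section \<open>Determinants of Vandermonde type\<close>

text \<open>The evaluation matrix is the Vandermonde matrix times the matrix of coefficients, and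
  the degree bound makes the latter upper triangular.\<close>

lemma det_poly_eval_mult:
  fixes x :: "nat \<Rightarrow> real" and P :: "nat \<Rightarrow> real poly"
  assumes deg: "\<And>j. j < n \<Longrightarrow> degree (P j) \<le> j"
  shows "det (mat n n (\<lambda>(i, j). poly (P j) (x i))) =
    det (mat n n (\<lambda>(i, j). x i ^ j)) * (\<Prod>j<n. coeff (P j) j)"
proof -
  let ?C = "mat n n (\<lambda>(i, j). coeff (P j) i)"
  have "mat n n (\<lambda>(i, j). poly (P j) (x i)) = mat n n (\<lambda>(i, j). x i ^ j) * ?C"
  proof (rule eq_matI)
    fix i j assume "i < dim_row (mat n n (\<lambda>(i, j). x i ^ j) * ?C)" "j < dim_col (mat n n (\<lambda>(i, j). x i ^ j) * ?C)"
    then have ij: "i < n" "j < n" by auto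
    have "poly (P j) (x i) = (\<Sum>k<n. x i ^ k * coeff (P j) k)"
      unfolding poly_altdef
      by (rule sum.mono_neutral_cong_left) (use deg[OF ij(2)] ij in \<open>auto simp: coeff_eq_0\<close>)
    with ij show "mat n n (\<lambda>(i, j). poly (P j) (x i)) $$ (i, j) = (mat n n (\<lambda>(i, j). x i ^ j) * ?C) $$ (i, j)"
      by (simp add: scalar_prod_def lessThan_atLeast0)
  qed auto
  moreover have "det ?C = (\<Prod>j<n. coeff (P j) j)"
  proof -
    have "upper_triangular ?C"
    proof (rule upper_triangularI)
      fix i j assume ji: "j < i" and "i < dim_row ?C"
      then have "degree (P j) < i" using deg[of j] by simp
      with ji \<open>i < dim_row ?C\<close> show "?C $$ (i, j) = 0" by (simp add: coeff_eq_0)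
    qed
    then have "det ?C = prod_list (diag_mat ?C)"
      by (rule det_upper_triangular) auto
    then show ?thesis by (simp add: prod_list_diag_prod lessThan_atLeast0)
  qed
  ultimately show ?thesis by (simp add: det_mult[of _ n])
qed

lemma prod_pairs_less: "(\<Prod>j<n. \<Prod>i<j. g i j) = pairprod {..<n} g"
proof -
  have "pairprod {..<n} g = (\<Prod>(j, i)\<in>(SIGMA j:{..<n}. {..<j}). g i j)"
    unfolding pairprod_def
    by (rule prod.reindex_bij_witness[of _ prod.swap prod.swap]) auto
  then show ?thesis by (simp add: prod.Sigma)
qed

text \<open>In the Newton basis the evaluation matrix is triangular.\<close>

lemma det_vandermonde:
  fixes x :: "nat \<Rightarrow> real"
  shows "det (mat n n (\<lambda>(i, j). x i ^ j)) = pairprod {..<n} (\<lambda>i j. x j - x i)"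
proof -
  let ?N = "\<lambda>j. \<Prod>m<j. [:- x m, 1:]"
  have deg: "degree (?N j) = j" for j
    by (subst degree_prod_sum_eq) auto
  have lead: "coeff (?N j) j = 1" for j
    using lead_coeff_prod[of "\<lambda>m. [:- x m, 1:]" "{..<j}"] unfolding deg by simp
  let ?M = "mat n n (\<lambda>(i, j). poly (?N j) (x i))"
  have "det ?M = prod_list (diag_mat ?M)"
    by (rule det_lower_triangular[of n]) (auto simp: poly_prod)
  also have "\<dots> = (\<Prod>j<n. \<Prod>i<j. x j - x i)"
    by (simp add: prod_list_diag_prod lessThan_atLeast0 poly_prod)
  \<comment> \<open>The Newton polynomials are monic, so the change from the monomial basis has
    determinant 1.\<close>
  finally show ?thesis
    using det_poly_eval_mult[of n ?N x] by (simp add: deg lead prod_pairs_less)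
qed

lemma det_generalized_vandermonde:
  fixes x :: "nat \<Rightarrow> real" and P :: "nat \<Rightarrow> real poly"
  assumes "\<And>j. j < n \<Longrightarrow> degree (P j) \<le> j"
  shows "det (mat n n (\<lambda>(i, j). poly (P j) (x i))) =
    pairprod {..<n} (\<lambda>i j. x j - x i) * (\<Prod>j<n. coeff (P j) j)"
  using det_poly_eval_mult[OF assms] by (simp add: det_vandermonde)

lemma det_permute_rows_fun:
  fixes f :: "nat \<Rightarrow> nat \<Rightarrow> real"
  assumes "p permutes {0..<n}"
  shows "det (mat n n (\<lambda>(i, j). f (p i) j)) = signof p * det (mat n n (\<lambda>(i, j). f i j))"
proof -
  have "mat n n (\<lambda>(i, j). f (p i) j) = mat n n (\<lambda>(i, j). mat n n (\<lambda>(i, j). f i j) $$ (p i, j))"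
    by (rule eq_matI) (use permutes_in_image[OF assms] in auto)
  then show ?thesis using det_permute_rows[OF _ assms, of "mat n n (\<lambda>(i, j). f i j)"] by simp
qed

text \<open>Rows and columns are permuted by the same reversal, so its sign occurs twice. This
  serves matrices whose column polynomials have decreasing degrees.\<close>

lemma det_mat_reverse:
  fixes f :: "nat \<Rightarrow> nat \<Rightarrow> real"
  shows "det (mat n n (\<lambda>(i, j). f (n - 1 - i) (n - 1 - j))) = det (mat n n (\<lambda>(i, j). f i j))"
proof -
  define p where "p = (\<lambda>i. if i < n then n - 1 - i else i)"
  have p: "p permutes {0..<n}"
    unfolding p_def by (rule bij_imp_permutes, rule bij_betwI[where g = "\<lambda>i. n - 1 - i"]) auto
  have tr: "det (mat n n (\<lambda>(i, j). g j i)) = det (mat n n (\<lambda>(i, j). g i j))"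
    for g :: "nat \<Rightarrow> nat \<Rightarrow> real"
  proof -
    have "mat n n (\<lambda>(i, j). g j i) = transpose_mat (mat n n (\<lambda>(i, j). g i j))"
      by (rule eq_matI) auto
    then show ?thesis using det_transpose[of "mat n n (\<lambda>(i, j). g i j)" n] by simp
  qed
  have "mat n n (\<lambda>(i, j). f (n - 1 - i) (n - 1 - j)) = mat n n (\<lambda>(i, j). f (p i) (p j))"
    by (rule eq_matI) (auto simp: p_def)
  also have "det \<dots> = signof p * det (mat n n (\<lambda>(i, j). f i (p j)))"
    by (rule det_permute_rows_fun[OF p])
  also have "det (mat n n (\<lambda>(i, j). f i (p j))) = det (mat n n (\<lambda>(i, j). f j (p i)))"
    by (rule tr[symmetric])
  also have "\<dots> = signof p * det (mat n n (\<lambda>(i, j). f j i))"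
    by (rule det_permute_rows_fun[OF p])
  also have "det (mat n n (\<lambda>(i, j). f j i)) = det (mat n n (\<lambda>(i, j). f i j))"
    by (rule tr)
  finally show ?thesis by (simp add: sign_def)
qed

section \<open>Symmetric sums over exponent vectors\<close>

text \<open>A bijection may reverse the order within a pair. The reindexing therefore sorts the two
  images by \<open>min\<close> and \<open>max\<close>, which is harmless for symmetric
  \<open>g\<close>.\<close>

lemma pairprod_bij:
  assumes h: "bij_betw h B A" and sym: "\<And>i j. i \<in> A \<Longrightarrow> j \<in> A \<Longrightarrow> g i j = g j i"
  shows "pairprod B (\<lambda>i j. g (h i) (h j)) = pairprod A g"
proof -
  let ?k = "inv_into B h"
  have hk: "h (?k a) = a" "?k a \<in> B" if "a \<in> A" for a
    using that h by (auto simp: bij_betw_inv_into_right bij_betw_def inv_into_into)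
  have kh: "?k (h b) = b" "h b \<in> A" if "b \<in> B" for b
    using that h by (auto simp: bij_betw_inv_into_left bij_betw_apply)
  let ?u = "\<lambda>(i, j). (min (?k i) (?k j), max (?k i) (?k j))"
  let ?v = "\<lambda>(i, j). (min (h i) (h j), max (h i) (h j))"
  let ?S = "\<lambda>A. {(i, j). i \<in> A \<and> j \<in> A \<and> i < j}"
  have v: "?u (?v z) = z" "?v z \<in> ?S A" "(case ?v z of (i, j) \<Rightarrow> g i j) = (case z of (i, j) \<Rightarrow> g (h i) (h j))"
    if zB: "z \<in> ?S B" for z
  proof -
    obtain i j where z: "z = (i, j)" and ij: "i \<in> B" "j \<in> B" "i < j" using zB by blast
    then have ne: "h i \<noteq> h j" using kh by (metis less_irrefl)
    show "?u (?v z) = z" "?v z \<in> ?S A" "(case ?v z of (i, j) \<Rightarrow> g i j) = (case z of (i, j) \<Rightarrow> g (h i) (h j))"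
      using z ij ne kh sym[of "h i" "h j"] by (auto simp: min_def max_def)
  qed
  have u: "?v (?u z) = z" "?u z \<in> ?S B" if zA: "z \<in> ?S A" for z
  proof -
    obtain i j where z: "z = (i, j)" and ij: "i \<in> A" "j \<in> A" "i < j" using zA by blast
    then have ne: "?k i \<noteq> ?k j" using hk by (metis less_irrefl)
    show "?v (?u z) = z" "?u z \<in> ?S B"
      using z ij ne hk by (auto simp: min_def max_def)
  qed
  show ?thesis
    unfolding pairprod_def by (rule prod.reindex_bij_witness[of _ ?u ?v]) (rule v u; assumption)+
qed

lemma pairprod_const:
  assumes "finite A"
  shows "pairprod A (\<lambda>i j. t) = t ^ (card A choose 2)"
  using assms
proof (induction A rule: finite_induct)
  case (insert a A)
  have "pairprod (insert a A) (\<lambda>i j. t) = pairprod A (\<lambda>i j. t) * t ^ card A"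
    using pairprod_remove[of "insert a A" a "\<lambda>i j. t"] insert by simp
  also have "\<dots> = t ^ (card (insert a A) choose 2)"
    using insert by (simp add: power_add numeral_2_eq_2)
  finally show ?case .
qed (simp add: numeral_2_eq_2)

text \<open>The series of a Jackson integral in terms of exponents: \<open>g\<close> is the
  interaction of two variables and \<open>w\<close> the weight of one, including the power of
  \<open>q\<close> from the Jackson measure.\<close>

definition pair_sum :: "(nat \<Rightarrow> nat \<Rightarrow> real) \<Rightarrow> (nat \<Rightarrow> real) \<Rightarrow> nat set \<Rightarrow> real" where
  "pair_sum g w A = infsum (\<lambda>k. pairprod A (\<lambda>i j. g (k i) (k j)) * (\<Prod>i\<in>A. w (k i))) (A \<rightarrow>\<^sub>E UNIV)"

lemma bij_betw_PiE_reindex: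
  assumes h: "bij_betw h B A"
  shows "bij_betw (\<lambda>k. \<lambda>i\<in>B. k (h i)) (A \<rightarrow>\<^sub>E C) (B \<rightarrow>\<^sub>E C)"
proof (rule bij_betwI[where g = "\<lambda>m. \<lambda>a\<in>A. m (inv_into B h a)"])
  let ?k = "inv_into B h"
  have hk: "h (?k a) = a" "?k a \<in> B" if "a \<in> A" for a
    using that h by (auto simp: bij_betw_inv_into_right bij_betw_def inv_into_into)
  have kh: "?k (h b) = b" "h b \<in> A" if "b \<in> B" for b
    using that h by (auto simp: bij_betw_inv_into_left bij_betw_apply)
  show "(\<lambda>k. \<lambda>i\<in>B. k (h i)) \<in> (A \<rightarrow>\<^sub>E C) \<rightarrow> (B \<rightarrow>\<^sub>E C)"
    using kh by (auto simp: restrict_PiE_iff)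
  show "(\<lambda>m. \<lambda>a\<in>A. m (?k a)) \<in> (B \<rightarrow>\<^sub>E C) \<rightarrow> (A \<rightarrow>\<^sub>E C)"
    using hk by (auto simp: restrict_PiE_iff)
  show "(\<lambda>a\<in>A. (\<lambda>i\<in>B. x (h i)) (?k a)) = x" if "x \<in> A \<rightarrow>\<^sub>E C" for x
    by (rule PiE_ext[OF _ that]) (use that hk in \<open>auto simp: restrict_PiE_iff\<close>)
  show "(\<lambda>i\<in>B. (\<lambda>a\<in>A. y (?k a)) (h i)) = y" if "y \<in> B \<rightarrow>\<^sub>E C" for y
    by (rule PiE_ext[OF _ that]) (use that kh in \<open>auto simp: restrict_PiE_iff\<close>)
qed

text \<open>Symmetry of \<open>g\<close> makes relabelling harmless, so only the number of variables
  counts. This identifies the different index sets left after removing a minimum.\<close>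

lemma pair_sum_eq_if_card_eq:
  assumes "finite A" "finite B" "card A = card B" and sym: "\<And>a b. g a b = g b a"
  shows "pair_sum g w A = pair_sum g w B"
proof -
  obtain h where h: "bij_betw h B A"
    using assms by (metis finite_same_card_bij)
  let ?F = "\<lambda>k. pairprod B (\<lambda>i j. g (k i) (k j)) * (\<Prod>i\<in>B. w (k i))"
  have "pair_sum g w B = infsum (\<lambda>k. ?F (\<lambda>i\<in>B. k (h i))) (A \<rightarrow>\<^sub>E UNIV)"
    unfolding pair_sum_def
    by (rule infsum_reindex_bij_betw[OF bij_betw_PiE_reindex[OF h], symmetric])
  also have "\<dots> = pair_sum g w A"
    unfolding pair_sum_def
  proof (rule infsum_cong)
    fix k :: "nat \<Rightarrow> nat"
    have "pairprod B (\<lambda>i j. g ((\<lambda>i\<in>B. k (h i)) i) ((\<lambda>i\<in>B. k (h i)) j)) = pairprod B (\<lambda>i j. g (k (h i)) (k (h j)))"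
      by (rule pairprod_cong) auto
    also have "\<dots> = pairprod A (\<lambda>i j. g (k i) (k j))"
      by (rule pairprod_bij[OF h]) (rule sym)
    moreover have "(\<Prod>i\<in>B. w ((\<lambda>i\<in>B. k (h i)) i)) = (\<Prod>i\<in>A. w (k i))"
      using prod.reindex_bij_betw[OF h, of "\<lambda>i. w (k i)"] by simp
    ultimately show "?F (\<lambda>i\<in>B. k (h i)) = pairprod A (\<lambda>i j. g (k i) (k j)) * (\<Prod>i\<in>A. w (k i))"
      by simp
  qed
  finally show ?thesis by simp
qed

lemma infsum_finite_sum:
  fixes f :: "'i \<Rightarrow> 'a \<Rightarrow> real"
  assumes "finite S" "\<And>i. i \<in> S \<Longrightarrow> f i summable_on A"
  shows "infsum (\<lambda>x. \<Sum>i\<in>S. f i x) A = (\<Sum>i\<in>S. infsum (f i) A)"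
proof -
  have "((\<lambda>x. \<Sum>i\<in>S. f i x) has_sum (\<Sum>i\<in>S. infsum (f i) A)) A"
    using assms by (induction S rule: finite_induct) (auto intro!: has_sum_add has_sum_infsum)
  then show ?thesis by (rule infsumI)
qed

lemma det_mat_leibniz:
  fixes f :: "nat \<Rightarrow> nat \<Rightarrow> real"
  shows "det (mat n n (\<lambda>(i, j). f i j)) = (\<Sum>p | p permutes {0..<n}. signof p * (\<Prod>i<n. f i (p i)))"
proof -
  have "(\<Prod>i<n. mat n n (\<lambda>(i, j). f i j) $$ (i, p i)) = (\<Prod>i<n. f i (p i))" if "p permutes {0..<n}" for p
    by (rule prod.cong) (use permutes_in_image[OF that] in auto)
  then show ?thesis
    by (subst det_def'[of _ n]) (simp_all add: lessThan_atLeast0)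
qed

text \<open>The product is a Vandermonde determinant whose rows are permuted by \<open>p\<close>;
  negated nodes give the differences in the required order.\<close>

lemma pairprod_diff_permute:
  assumes "p permutes {0..<n}"
  shows "pairprod {..<n} (\<lambda>i j. y (p i) - y (p j)) = signof p * pairprod {..<n} (\<lambda>i j. y i - y j)"
  using det_vandermonde[of n "\<lambda>i. - y (p i)"] det_vandermonde[of n "\<lambda>i. - y i"]
    det_permute_rows_fun[OF assms, of "\<lambda>i j. (- y i) ^ j"] by simp

section \<open>The sums behind the first two integrals\<close>

lemma pair_sum_abs_diff:
  fixes q :: real
  assumes q: "0 < q" "q < 1"
  shows "pair_sum (\<lambda>a b. \<bar>q ^ b - q ^ a\<bar>) (\<lambda>a. q ^ ((r + 1) * a)) {..<n} =
    fact n * ((\<Prod>i<n. 1 / (1 - q ^ (r + 1 + i))) *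
      pairprod {..<n} (\<lambda>i j. (q ^ (r + 1 + i) - q ^ (r + 1 + j)) / (1 - q ^ (r + 1 + i) * q ^ (r + 1 + j))))"
proof -
  define y where "y i = q ^ (r + 1 + i)" for i
  have y: "0 < y i" "y i < 1" for i
    using q power_Suc_less_one[of q "r + i"] by (auto simp: y_def)
  have inj_y: "inj y"
  proof (rule linorder_injI)
    fix i j :: nat assume "i < j"
    then have "y j < y i"
      unfolding y_def by (intro power_strict_decreasing) (use q in auto)
    then show "y i \<noteq> y j" by simp
  qed
  let ?P = "{p. p permutes {0..<n}}"
  let ?t = "\<lambda>p k. signof p * (order_sign {..<n} k * (\<Prod>i<n. y (p i) ^ k i)) :: real"
  have expand: "pairprod {..<n} (\<lambda>i j. \<bar>q ^ k j - q ^ k i\<bar>) * (\<Prod>i<n. q ^ ((r + 1) * k i)) = (\<Sum>p\<in>?P. ?t p k)"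
    for k :: "nat \<Rightarrow> nat"
  proof -
    have "pairprod {..<n} (\<lambda>i j. \<bar>q ^ k j - q ^ k i\<bar>) =
        pairprod {..<n} (\<lambda>i j. sgn (real (k i) - real (k j)) * (q ^ k j - q ^ k i))"
    proof (rule pairprod_cong)
      fix i j
      \<comment> \<open>As 0 < q < 1, \<open>q ^ k j\<close> exceeds \<open>q ^ k i\<close> exactly
        when \<open>k i\<close> exceeds \<open>k j\<close>; hence the order of the terms inside
        \<open>sgn\<close>.\<close>
      show "\<bar>q ^ k j - q ^ k i\<bar> = sgn (real (k i) - real (k j)) * (q ^ k j - q ^ k i)"
        using q power_strict_decreasing[of "k i" "k j" q] power_strict_decreasing[of "k j" "k i" q]
        by (cases "k i" "k j" rule: linorder_cases) auto
    qed
    also have "\<dots> = order_sign {..<n} k * det (mat n n (\<lambda>(i, j). (q ^ k i) ^ j))"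
      by (simp add: pairprod_mult order_sign_def det_vandermonde)
    also have "\<dots> * (\<Prod>i<n. q ^ ((r + 1) * k i)) = (\<Sum>p\<in>?P. ?t p k)"
      unfolding det_mat_leibniz sum_distrib_left sum_distrib_right
    proof (rule sum.cong[OF refl])
      fix p
      \<comment> \<open>The weight of \<open>k i\<close> and the determinant entry in row
        \<open>i\<close> and column \<open>p i\<close> merge into one power of
        \<open>y (p i)\<close>.\<close>
      have "(\<Prod>i<n. y (p i) ^ k i) = (\<Prod>i<n. (q ^ k i) ^ p i) * (\<Prod>i<n. q ^ ((r + 1) * k i))"
        unfolding prod.distrib[symmetric]
        by (rule prod.cong) (auto simp: y_def power_add power_mult[symmetric] algebra_simps)
      then show "order_sign {..<n} k * (signof p * (\<Prod>i<n. (q ^ k i) ^ p i)) * (\<Prod>i<n. q ^ ((r + 1) * k i)) = ?t p k"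
        by simp
    qed
    finally show ?thesis .
  qed
  let ?C = "(\<Prod>i<n. 1 / (1 - y i)) * pairprod {..<n} (\<lambda>i j. (y i - y j) / (1 - y i * y j))"
  have "pair_sum (\<lambda>a b. \<bar>q ^ b - q ^ a\<bar>) (\<lambda>a. q ^ ((r + 1) * a)) {..<n} =
      infsum (\<lambda>k. \<Sum>p\<in>?P. ?t p k) ({..<n} \<rightarrow>\<^sub>E UNIV)"
    unfolding pair_sum_def expand ..
  also have "\<dots> = (\<Sum>p\<in>?P. infsum (?t p) ({..<n} \<rightarrow>\<^sub>E UNIV))"
  proof (rule infsum_finite_sum)
    fix p assume "p \<in> ?P"
    show "?t p summable_on ({..<n} \<rightarrow>\<^sub>E UNIV)"
    proof (rule summable_on_PiE_bounded)
      show "\<bar>?t p k\<bar> \<le> (\<Prod>i<n. y (p i) ^ k i)" for k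
      proof -
        have "0 \<le> (\<Prod>i<n. y (p i) ^ k i)"
          by (rule prod_nonneg) (use y in \<open>auto intro: less_imp_le\<close>)
        then show ?thesis
          using abs_order_sign_le_1[of "{..<n}" k]
          by (simp add: abs_mult mult_left_le_one_le sign_def)
      qed
    qed (use y in \<open>auto intro: less_imp_le\<close>)
  qed (simp add: finite_permutations)
  also have "\<dots> = (\<Sum>p\<in>?P. ?C)"
  proof (rule sum.cong[OF refl])
    fix p assume "p \<in> ?P"
    then have p: "p permutes {0..<n}" by simp
    then have p': "p permutes {..<n}" by (simp add: lessThan_atLeast0)
    have "infsum (?t p) ({..<n} \<rightarrow>\<^sub>E UNIV) = signof p * ((\<Prod>i<n. 1 / (1 - y (p i))) *
        pairprod {..<n} (\<lambda>i j. (y (p i) - y (p j)) / (1 - y (p i) * y (p j))))"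
      unfolding infsum_cmult_right'
      using infsum_order_sign[of "{..<n}" "\<lambda>i. y (p i)"] y
        inj_on_subset[OF inj_compose[OF inj_y permutes_inj[OF p]], of "{..<n}"] by (simp add: o_def)
    also have "(\<Prod>i<n. 1 / (1 - y (p i))) = (\<Prod>i<n. 1 / (1 - y i))"
      using prod.permute[OF p', of "\<lambda>i. 1 / (1 - y i)"] by (simp add: o_def)
    \<comment> \<open>The numerators alternate and yield \<open>signof p\<close>, while the
      denominators are symmetric. With the sign of the Leibniz expansion the total sign is 1, so all
      \<open>p\<close> contribute equally.\<close>
    also have "pairprod {..<n} (\<lambda>i j. (y (p i) - y (p j)) / (1 - y (p i) * y (p j))) =
        signof p * pairprod {..<n} (\<lambda>i j. (y i - y j) / (1 - y i * y j))"
      unfolding pairprod_divide pairprod_diff_permute[OF p]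
      using pairprod_bij[OF permutes_imp_bij[OF p'], of "\<lambda>i j. 1 - y i * y j"] by (simp add: mult.commute)
    finally show "infsum (?t p) ({..<n} \<rightarrow>\<^sub>E UNIV) = ?C"
      by (simp add: sign_def)
  qed
  also have "\<dots> = fact n * ?C"
    by (simp add: card_permutations)
  finally show ?thesis unfolding y_def .
qed

text \<open>Let \<open>c\<close> be the minimal exponent and \<open>c + 1 + m i\<close> the others.
  The differences to the removed variable are \<open>q ^ c * (1 - q * q ^ m i)\<close>, which
  supplies the extra weight on the right. All \<open>n + 1\<close> positions of the minimum
  contribute equally, and summing over \<open>c\<close> gives a geometric series.\<close>

lemma pair_sum_abs_diff_remove_min:
  fixes q :: real
  assumes q: "0 < q" "q < 1"
  shows "pair_sum (\<lambda>a b. \<bar>q ^ b - q ^ a\<bar>) (\<lambda>a. q ^ ((r + 1) * a)) {..<Suc n} * (1 - q ^ ((n + 1) * (r + 1) + (Suc n choose 2))) =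
    real (Suc n) * q ^ ((r + 1) * n + (n choose 2)) *
      pair_sum (\<lambda>a b. \<bar>q ^ b - q ^ a\<bar>) (\<lambda>a. (1 - q * q ^ a) * q ^ ((r + 1) * a)) {..<n}"
proof -
  let ?g = "\<lambda>a b. \<bar>q ^ b - q ^ a\<bar>"
  let ?w = "\<lambda>a. q ^ ((r + 1) * a)"
  let ?v = "\<lambda>a. (1 - q * q ^ a) * q ^ ((r + 1) * a)"
  let ?A = "{..<Suc n}"
  let ?f = "\<lambda>k. pairprod ?A (\<lambda>i j. ?g (k i) (k j)) * (\<Prod>i\<in>?A. ?w (k i))"
  \<comment> \<open>\<open>?E\<close> is the degree in \<open>c\<close>: \<open>r + 1\<close> for
    each of the \<open>n + 1\<close> weights and 1 for each pair. \<open>?D\<close> comes from the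
    additional shift by 1 of the \<open>n\<close> remaining exponents, in their weights and in the
    pairs among them.\<close>
  let ?E = "(n + 1) * (r + 1) + (Suc n choose 2)"
  let ?D = "q ^ ((r + 1) * n + (n choose 2))"
  have gle: "0 \<le> ?g a b \<and> ?g a b \<le> 1" for a b
    using q power_le_one[of q a] power_le_one[of q b] zero_le_power[of q a] zero_le_power[of q b] by linarith
  have sum: "?f summable_on (?A \<rightarrow>\<^sub>E UNIV)"
  proof (rule summable_on_PiE_bounded)
    show "\<bar>?f k\<bar> \<le> (\<Prod>i\<in>?A. (q ^ (r + 1)) ^ k i)" for k
    proof -
      have "0 \<le> pairprod ?A (\<lambda>i j. ?g (k i) (k j))" "pairprod ?A (\<lambda>i j. ?g (k i) (k j)) \<le> 1"
        unfolding pairprod_def using gle by (auto intro!: prod_nonneg prod_le_1 simp: case_prod_unfold)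
      moreover have "0 \<le> (\<Prod>i\<in>?A. ?w (k i))"
        by (rule prod_nonneg) (use q in auto)
      ultimately show ?thesis
        by (simp only: abs_mult abs_of_nonneg power_mult mult_left_le_one_le)
    qed
  qed (use q in \<open>auto simp: power_Suc_less_one simp del: power_Suc\<close>)
  have ne: "?A \<noteq> {}" by blast
  have zero: "?f k = 0" if "\<not> inj_on k ?A" for k
    using pairprod_eq_0_if_not_inj[OF _ that, of "\<lambda>i j. ?g (k i) (k j)"] by simp
  have term_eq: "infsum (\<lambda>(c, m). ?f (insert_min ?A a c m)) (UNIV \<times> ((?A - {a}) \<rightarrow>\<^sub>E UNIV)) =
      1 / (1 - q ^ ?E) * (?D * pair_sum ?g ?v {..<n})" if a: "a \<in> ?A" for a
  proof -
    let ?B = "?A - {a}"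
    have card: "card ?B = n" using a by simp
    have f: "?f (insert_min ?A a c m) =
        (q ^ ?E) ^ c * (?D * (pairprod ?B (\<lambda>i j. ?g (m i) (m j)) * (\<Prod>i\<in>?B. ?v (m i))))" for c m
    proof -
      let ?k = "insert_min ?A a c m"
      have "pairprod ?B (\<lambda>i j. ?g (?k i) (?k j)) = pairprod ?B (\<lambda>i j. q ^ (c + 1) * ?g (m i) (m j))"
      proof (rule pairprod_cong)
        fix i j assume "i \<in> ?B" "j \<in> ?B"
        then have "q ^ ?k j - q ^ ?k i = q ^ (c + 1) * (q ^ m j - q ^ m i)"
          by (simp add: insert_min_at power_add algebra_simps)
        then show "?g (?k i) (?k j) = q ^ (c + 1) * ?g (m i) (m j)"
          using q by (simp add: abs_mult)
      qed
      also have "\<dots> = (q ^ (c + 1)) ^ (n choose 2) * pairprod ?B (\<lambda>i j. ?g (m i) (m j))"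
        by (simp only: pairprod_mult pairprod_const[OF finite_Diff[OF finite_lessThan]] card)
      finally have 1: "pairprod ?B (\<lambda>i j. ?g (?k i) (?k j)) =
          (q ^ (c + 1)) ^ (n choose 2) * pairprod ?B (\<lambda>i j. ?g (m i) (m j))" .
      have "(\<Prod>i\<in>?B. if i < a then ?g (?k i) (?k a) else ?g (?k a) (?k i)) = (\<Prod>i\<in>?B. q ^ c * (1 - q * q ^ m i))"
      proof (rule prod.cong[OF refl])
        fix i assume i: "i \<in> ?B"
        have "q * q ^ m i \<le> 1" using q power_le_one[of q "Suc (m i)"] by simp
        then have "\<bar>q ^ c - q ^ (c + 1 + m i)\<bar> = q ^ c * (1 - q * q ^ m i)"
          using q by (simp add: power_add algebra_simps mult_left_le)
        then show "(if i < a then ?g (?k i) (?k a) else ?g (?k a) (?k i)) = q ^ c * (1 - q * q ^ m i)"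
          using i a by (simp add: insert_min_at abs_minus_commute)
      qed
      then have 2: "(\<Prod>i\<in>?B. if i < a then ?g (?k i) (?k a) else ?g (?k a) (?k i)) =
          (q ^ c) ^ n * (\<Prod>i\<in>?B. 1 - q * q ^ m i)"
        by (simp only: prod.distrib prod_constant card)
      have "(\<Prod>i\<in>?A. ?w (?k i)) = (\<Prod>i\<in>?A. (q ^ (r + 1)) ^ ?k i)"
        by (simp only: power_mult)
      also have "\<dots> = ((q ^ (r + 1)) ^ Suc n) ^ c * ((q ^ (r + 1)) ^ n * (\<Prod>i\<in>?B. (q ^ (r + 1)) ^ m i))"
        by (simp only: prod_power_insert_min[OF finite_lessThan a] prod_constant card card_lessThan)
      finally have 3: "(\<Prod>i\<in>?A. ?w (?k i)) =
          ((q ^ (r + 1)) ^ Suc n) ^ c * ((q ^ (r + 1)) ^ n * (\<Prod>i\<in>?B. ?w (m i)))"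
        by (simp only: power_mult)
      have 4: "(q ^ (c + 1)) ^ (n choose 2) * (q ^ c) ^ n * (((q ^ (r + 1)) ^ Suc n) ^ c * (q ^ (r + 1)) ^ n) =
          (q ^ ?E) ^ c * ?D"
      proof -
        have "(Suc n choose 2) = (n choose 2) + n" by (simp add: numeral_2_eq_2)
        then show ?thesis
          by (simp only: power_mult[symmetric] power_add[symmetric]) (simp add: algebra_simps)
      qed
      have "?f ?k = (q ^ (c + 1)) ^ (n choose 2) * (q ^ c) ^ n * (((q ^ (r + 1)) ^ Suc n) ^ c * (q ^ (r + 1)) ^ n) *
          (pairprod ?B (\<lambda>i j. ?g (m i) (m j)) * ((\<Prod>i\<in>?B. 1 - q * q ^ m i) * (\<Prod>i\<in>?B. ?w (m i))))"
        by (simp only: pairprod_remove[OF finite_lessThan a] 1 2 3 mult_ac)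
      then show ?thesis unfolding 4 prod.distrib by (simp only: mult_ac)
    qed
    have "infsum (\<lambda>(c, m). ?f (insert_min ?A a c m)) (UNIV \<times> (?B \<rightarrow>\<^sub>E UNIV)) =
        infsum (\<lambda>c. (q ^ ?E) ^ c) UNIV * infsum (\<lambda>m. ?D * (pairprod ?B (\<lambda>i j. ?g (m i) (m j)) * (\<Prod>i\<in>?B. ?v (m i)))) (?B \<rightarrow>\<^sub>E UNIV)"
      using infsum_PiE_by_argmin(2)[OF finite_lessThan ne sum zero a]
      unfolding f by (rule infsum_Times_mult)
    also have "\<dots> = 1 / (1 - q ^ ?E) * (?D * pair_sum ?g ?v ?B)"
    proof -
      have "q ^ ?E < 1" using q power_Suc_less_one[of q "?E - 1"] by simp
      then show ?thesis
        using q by (simp only: infsum_geometric infsum_cmult_right' pair_sum_def zero_le_power less_imp_le)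
    qed
    also have "pair_sum ?g ?v ?B = pair_sum ?g ?v {..<n}"
      by (rule pair_sum_eq_if_card_eq) (use card in \<open>auto simp: abs_minus_commute\<close>)
    finally show ?thesis .
  qed
  have "pair_sum ?g ?w ?A = (\<Sum>a\<in>?A. infsum (\<lambda>(c, m). ?f (insert_min ?A a c m)) (UNIV \<times> ((?A - {a}) \<rightarrow>\<^sub>E UNIV)))"
    unfolding pair_sum_def by (rule infsum_PiE_by_argmin(1)[OF finite_lessThan ne sum zero])
  also have "\<dots> = (\<Sum>a\<in>?A. 1 / (1 - q ^ ?E) * (?D * pair_sum ?g ?v {..<n}))"
    by (rule sum.cong[OF refl term_eq])
  also have "\<dots> = real (Suc n) * ?D * pair_sum ?g ?v {..<n} / (1 - q ^ ?E)"
    by simp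
  finally show ?thesis
    using q power_Suc_less_one[of q "?E - 1"] by simp
qed

section \<open>The determinant of q-beta integrals\<close>

text \<open>The standard symbol \<open>(y; q)_m\<close>, which starts at exponent 0, in contrast to
  \<open>qx_poch\<close>.\<close>

definition qpoch :: "real \<Rightarrow> real \<Rightarrow> nat \<Rightarrow> real" where
  "qpoch q y m = (\<Prod>i<m. 1 - y * q ^ i)"

lemma qpoch_Suc: "qpoch q y (Suc m) = qpoch q y m * (1 - y * q ^ m)"
  by (simp add: qpoch_def)

lemma qpoch_Suc_shift: "qpoch q y (Suc m) = (1 - y) * qpoch q (q * y) m"
  unfolding qpoch_def prod.lessThan_Suc_shift by (simp add: mult_ac)

lemma qpoch_add: "qpoch q y (m + l) = qpoch q y m * qpoch q (y * q ^ m) l"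
  by (induction l) (simp_all add: qpoch_def power_add mult_ac)

lemma qpoch_pos:
  assumes "0 < q" "q < 1" "0 \<le> y" "y < 1"
  shows "0 < qpoch q y m"
  unfolding qpoch_def
proof (rule prod_pos)
  fix i assume "i \<in> {..<m}"
  have "y * q ^ i \<le> y * 1" using assms by (intro mult_left_mono power_le_one) auto
  then show "0 < 1 - y * q ^ i" using assms by simp
qed

lemma qpoch_bounds:
  assumes "0 < q" "q < 1" "0 \<le> y" "y \<le> 1"
  shows "0 \<le> qpoch q y m" "qpoch q y m \<le> 1"
proof -
  have "0 \<le> y * q ^ i \<and> y * q ^ i \<le> 1" for i
    using assms by (auto intro!: mult_le_one power_le_one)
  then show "0 \<le> qpoch q y m" "qpoch q y m \<le> 1"
    unfolding qpoch_def by (auto intro!: prod_nonneg prod_le_1)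
qed

lemma summable_power_qpoch:
  fixes q y :: real
  assumes q: "0 < q" "q < 1" and y: "0 \<le> y" "y < 1"
  shows "(\<lambda>k. y ^ k * qpoch q (q ^ Suc k) m) summable_on (UNIV :: nat set)"
proof (rule summable_on_comparison_test)
  show "(\<lambda>k. y ^ k) summable_on (UNIV :: nat set)"
    using norm_summable_imp_has_sum[OF _ geometric_sums[of y]] y
    by (auto simp: summable_on_def summable_geometric)
  fix k :: nat
  have "0 \<le> qpoch q (q ^ Suc k) m" "qpoch q (q ^ Suc k) m \<le> 1"
    using q power_le_one[of q "Suc k"] by (auto intro!: qpoch_bounds simp del: power_Suc)
  then show "y ^ k * qpoch q (q ^ Suc k) m \<le> y ^ k" "0 \<le> y ^ k * qpoch q (q ^ Suc k) m"
    using y by (auto simp: mult_left_le)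
qed

text \<open>This is the q-beta integral as a series. Splitting the last factor
  \<open>1 - q ^ (k + 1 + m)\<close> leaves two sums with \<open>m\<close> factors, at
  \<open>y\<close> and at \<open>q * y\<close>; hence the induction over arbitrary
  \<open>y\<close>.\<close>

lemma infsum_power_qpoch:
  fixes q y :: real
  assumes q: "0 < q" "q < 1" and y: "0 \<le> y" "y < 1"
  shows "infsum (\<lambda>k. y ^ k * qpoch q (q ^ Suc k) m) (UNIV :: nat set) = qpoch q q m / qpoch q y (Suc m)"
  using y
proof (induction m arbitrary: y)
  case 0
  then show ?case by (simp add: qpoch_def infsum_geometric)
next
  case (Suc m)
  have qy: "0 \<le> q * y" "q * y < 1"
    using Suc.prems q mult_left_le_one_le[of y q] by auto
  have "infsum (\<lambda>k. y ^ k * qpoch q (q ^ Suc k) (Suc m)) (UNIV :: nat set) =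
      infsum (\<lambda>k. y ^ k * qpoch q (q ^ Suc k) m + - (q ^ Suc m) * ((q * y) ^ k * qpoch q (q ^ Suc k) m)) UNIV"
    by (rule infsum_cong) (simp add: qpoch_Suc power_mult_distrib algebra_simps)
  also have "\<dots> = qpoch q q m / qpoch q y (Suc m) + - (q ^ Suc m) * (qpoch q q m / qpoch q (q * y) (Suc m))"
    unfolding infsum_add[OF summable_power_qpoch[OF q Suc.prems] summable_on_cmult_right[OF summable_power_qpoch[OF q qy]]]
      infsum_cmult_right' Suc.IH[OF Suc.prems] Suc.IH[OF qy] ..
  also have "\<dots> = qpoch q q (Suc m) / qpoch q y (Suc (Suc m))"
  proof -
    define R where "R = qpoch q (q * y) m"
    have R: "R \<noteq> 0" using qpoch_pos[OF q qy, of m] by (simp add: R_def)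
    have s: "1 - y * q ^ Suc m \<noteq> 0"
      using mult_left_le[of "q ^ Suc m" y] power_le_one[of q "Suc m"] q Suc.prems by simp
    have "qpoch q y (Suc m) = (1 - y) * R" "qpoch q (q * y) (Suc m) = R * (1 - y * q ^ Suc m)"
      "qpoch q y (Suc (Suc m)) = (1 - y) * R * (1 - y * q ^ Suc m)" "qpoch q q (Suc m) = qpoch q q m * (1 - q ^ Suc m)"
      by (simp_all only: R_def qpoch_Suc_shift[of q y m] qpoch_Suc[of q _ "Suc m"])
        (simp_all add: qpoch_Suc mult_ac)
    then show ?thesis
      using R s Suc.prems by (simp add: divide_simps) (simp add: algebra_simps)
  qed
  finally show ?case .
qed

lemma det_scale_rows_cols:
  fixes f :: "nat \<Rightarrow> nat \<Rightarrow> real"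
  shows "det (mat n n (\<lambda>(i, j). a i * b j * f i j)) = (\<Prod>i<n. a i) * (\<Prod>j<n. b j) * det (mat n n (\<lambda>(i, j). f i j))"
  unfolding det_mat_leibniz[of n "\<lambda>i j. a i * b j * f i j"] det_mat_leibniz[of n f] sum_distrib_left
proof (rule sum.cong[OF refl])
  fix p assume "p \<in> {p. p permutes {0..<n}}"
  then have "p permutes {..<n}" by (simp add: lessThan_atLeast0)
  then have "(\<Prod>i<n. b (p i)) = (\<Prod>i<n. b i)"
    using prod.permute[of p "{..<n}" b] by (simp add: o_def)
  then show "signof p * (\<Prod>i<n. a i * b (p i) * f i (p i)) =
      (\<Prod>i<n. a i) * (\<Prod>j<n. b j) * (signof p * (\<Prod>i<n. f i (p i)))"
    by (simp add: prod.distrib)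
qed

lemma coeff_prod_linear:
  fixes c :: "nat \<Rightarrow> real"
  shows "degree (\<Prod>i<m. [:1, c i:]) \<le> m" "coeff (\<Prod>i<m. [:1, c i:]) m = (\<Prod>i<m. c i)"
proof (induction m)
  case (Suc m)
  let ?P = "\<Prod>i<m. [:1, c i:]"
  { case 1
    have "degree (?P * [:1, c m:]) \<le> degree ?P + degree [:1, c m:]" by (rule degree_mult_le)
    also have "\<dots> \<le> Suc m" using Suc.IH(1) degree_pCons_le[of 1 "[:c m:]"] by simp
    finally show ?case by simp }
  { case 2
    have "coeff ?P (Suc m) = 0" using Suc.IH(1) by (intro coeff_eq_0) simp
    then show ?case using Suc.IH(2) by (simp add: coeff_pCons) }
qed simp_all

text \<open>The denominators in row \<open>i\<close> all divide
  \<open>qpoch q (y i) (s + n)\<close>. Taking this out of the rows and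
  \<open>qpoch q q (s + j)\<close> out of the columns leaves polynomials in \<open>y i\<close> of
  degree at most \<open>n - 1 - j\<close>, a generalized Vandermonde matrix after reversal.\<close>

lemma det_qbeta:
  fixes q :: real
  assumes q: "0 < q" "q < 1"
  shows "det (mat n n (\<lambda>(i, j). qpoch q q (s + j) / qpoch q (q ^ (r + 1 + i)) (Suc (s + j)))) =
    (\<Prod>j<n. qpoch q q (s + j)) * (\<Prod>j<n. \<Prod>i<j. - (q ^ (s + n - j + i))) / (\<Prod>i<n. qpoch q (q ^ (r + 1 + i)) (s + n)) *
      pairprod {..<n} (\<lambda>i j. q ^ (r + 1 + i) - q ^ (r + 1 + j))"
proof -
  define y where "y i = q ^ (r + 1 + i)" for i
  have y: "0 \<le> y i" "y i < 1" for i
    using q power_Suc_less_one[of q "r + i"] by (auto simp: y_def)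
  \<comment> \<open>\<open>D j\<close> is the tail that completes
    \<open>qpoch q (y i) (Suc (s + j))\<close> to the common row denominator.\<close>
  define D where "D j = (\<Prod>i<n - 1 - j. [:1, - (q ^ (s + j + 1 + i)):])" for j
  have polyD: "poly (D j) x = qpoch q (x * q ^ (s + j + 1)) (n - 1 - j)" for x j
    unfolding D_def poly_prod qpoch_def by (simp add: power_add mult_ac)
  have "det (mat n n (\<lambda>(i, j). qpoch q q (s + j) / qpoch q (y i) (Suc (s + j)))) =
      det (mat n n (\<lambda>(i, j). 1 / qpoch q (y i) (s + n) * qpoch q q (s + j) * poly (D j) (y i)))"
  proof (rule arg_cong[where f = det], rule eq_matI)
    fix i j assume "i < dim_row (mat n n (\<lambda>(i, j). 1 / qpoch q (y i) (s + n) * qpoch q q (s + j) * poly (D j) (y i)))"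
      "j < dim_col (mat n n (\<lambda>(i, j). 1 / qpoch q (y i) (s + n) * qpoch q q (s + j) * poly (D j) (y i)))"
    then have ij: "i < n" "j < n" by auto
    then have "s + n = Suc (s + j) + (n - 1 - j)" by simp
    then have split: "qpoch q (y i) (s + n) = qpoch q (y i) (Suc (s + j)) * poly (D j) (y i)"
      by (simp only: polyD qpoch_add) simp
    have "qpoch q (y i) (s + n) \<noteq> 0" using qpoch_pos[OF q y, of i "s + n"] by simp
    then have "qpoch q (y i) (Suc (s + j)) \<noteq> 0" "poly (D j) (y i) \<noteq> 0"
      unfolding split by auto
    then show "mat n n (\<lambda>(i, j). qpoch q q (s + j) / qpoch q (y i) (Suc (s + j))) $$ (i, j) =
        mat n n (\<lambda>(i, j). 1 / qpoch q (y i) (s + n) * qpoch q q (s + j) * poly (D j) (y i)) $$ (i, j)"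
      using ij by (simp add: split)
  qed auto
  also have "\<dots> = (\<Prod>i<n. 1 / qpoch q (y i) (s + n)) * (\<Prod>j<n. qpoch q q (s + j)) *
      det (mat n n (\<lambda>(i, j). poly (D j) (y i)))"
    by (rule det_scale_rows_cols)
  also have "det (mat n n (\<lambda>(i, j). poly (D j) (y i))) =
      det (mat n n (\<lambda>(i, j). poly (D (n - 1 - j)) (y (n - 1 - i))))"
    by (rule det_mat_reverse[symmetric])
  also have "\<dots> = pairprod {..<n} (\<lambda>i j. y (n - 1 - j) - y (n - 1 - i)) * (\<Prod>j<n. coeff (D (n - 1 - j)) j)"
  proof (rule det_generalized_vandermonde)
    fix j assume "j < n"
    then have "n - 1 - (n - 1 - j) = j" by simp
    then show "degree (D (n - 1 - j)) \<le> j"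
      unfolding D_def by (metis coeff_prod_linear(1))
  qed
  also have "(\<Prod>j<n. coeff (D (n - 1 - j)) j) = (\<Prod>j<n. \<Prod>i<j. - (q ^ (s + n - j + i)))"
  proof (rule prod.cong[OF refl])
    fix j assume "j \<in> {..<n}"
    then have j: "n - 1 - (n - 1 - j) = j" "s + (n - 1 - j) + 1 = s + n - j" by auto
    show "coeff (D (n - 1 - j)) j = (\<Prod>i<j. - (q ^ (s + n - j + i)))"
      unfolding D_def j by (rule coeff_prod_linear(2))
  qed
  \<comment> \<open>All these differences are nonnegative, so absolute values may be inserted; the
    product is then symmetric and the reversal can be undone by reindexing.\<close>
  also have "pairprod {..<n} (\<lambda>i j. y (n - 1 - j) - y (n - 1 - i)) = pairprod {..<n} (\<lambda>i j. \<bar>y (n - 1 - i) - y (n - 1 - j)\<bar>)"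
  proof (rule pairprod_cong)
    fix i j :: nat assume "i < j"
    then have "y (n - 1 - i) \<le> y (n - 1 - j)"
      using q unfolding y_def by (intro power_decreasing) auto
    then show "y (n - 1 - j) - y (n - 1 - i) = \<bar>y (n - 1 - i) - y (n - 1 - j)\<bar>" by simp
  qed
  also have "\<dots> = pairprod {..<n} (\<lambda>i j. \<bar>y i - y j\<bar>)"
    by (rule pairprod_bij, rule bij_betwI[where g = "\<lambda>i. n - 1 - i"]) (auto simp: abs_minus_commute)
  also have "\<dots> = pairprod {..<n} (\<lambda>i j. y i - y j)"
  proof (rule pairprod_cong)
    fix i j :: nat assume "i < j"
    then have "y j \<le> y i"
      using q unfolding y_def by (intro power_decreasing) auto
    then show "\<bar>y i - y j\<bar> = y i - y j" by simp
  qed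
  finally show ?thesis
    by (simp add: y_def prod_dividef)
qed

text \<open>One of the two Vandermonde factors is expanded in the basis \<open>(q\<^sup>s\<^sup>+\<^sup>1 x; q)\<^sub>j\<close>, which merges
  with the weight into \<open>(qx; q)\<^sub>s\<^sub>+\<^sub>j\<close>.\<close>

lemma pair_sum_diff_square:
  fixes q :: real
  assumes q: "0 < q" "q < 1"
  shows "pair_sum (\<lambda>a b. \<bar>q ^ b - q ^ a\<bar> ^ 2) (\<lambda>a. q ^ ((r + 1) * a) * qpoch q (q ^ Suc a) s) {..<n} *
      (\<Prod>j<n. \<Prod>i<j. - (q ^ (s + 1 + i))) =
    fact n * det (mat n n (\<lambda>(i, j). qpoch q q (s + j) / qpoch q (q ^ (r + 1 + i)) (Suc (s + j))))"
proof -
  define y where "y i = q ^ (r + 1 + i)" for i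
  have y: "0 \<le> y i" "y i < 1" for i
    using q power_Suc_less_one[of q "r + i"] by (auto simp: y_def)
  define P where "P j = (\<Prod>i<j. [:1, - (q ^ (s + 1 + i)):])" for j
  let ?c = "\<Prod>j<n. \<Prod>i<j. - (q ^ (s + 1 + i))"
  have polyP: "qpoch q (q ^ Suc a) s * poly (P j) (q ^ a) = qpoch q (q ^ Suc a) (s + j)" for a j
    unfolding qpoch_add P_def poly_prod unfolding qpoch_def by (simp add: power_add mult_ac)
  let ?S = "{p. p permutes {0..<n}}"
  let ?F = "\<lambda>p p' i a. y (p i) ^ a * qpoch q (q ^ Suc a) (s + p' i)"
  let ?t = "\<lambda>p p' k. signof p * signof p' * (\<Prod>i<n. ?F p p' i (k i)) :: real"
  let ?M = "\<lambda>i j. qpoch q q (s + j) / qpoch q (y i) (Suc (s + j))"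
  have expand: "pairprod {..<n} (\<lambda>i j. \<bar>q ^ k j - q ^ k i\<bar> ^ 2) * (\<Prod>i<n. q ^ ((r + 1) * k i) * qpoch q (q ^ Suc (k i)) s) * ?c =
      (\<Sum>p\<in>?S. \<Sum>p'\<in>?S. ?t p p' k)" for k :: "nat \<Rightarrow> nat"
  proof -
    let ?V = "pairprod {..<n} (\<lambda>i j. q ^ k j - q ^ k i)"
    let ?W = "\<Prod>i<n. q ^ ((r + 1) * k i) * qpoch q (q ^ Suc (k i)) s"
    have V1: "?V = (\<Sum>p\<in>?S. signof p * (\<Prod>i<n. (q ^ k i) ^ p i))"
      unfolding det_vandermonde[symmetric] det_mat_leibniz ..
    have "?V * ?c = det (mat n n (\<lambda>(i, j). poly (P j) (q ^ k i)))"
      by (subst det_generalized_vandermonde) (auto simp: P_def coeff_prod_linear)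
    then have V2: "?V * ?c = (\<Sum>p'\<in>?S. signof p' * (\<Prod>i<n. poly (P (p' i)) (q ^ k i)))"
      unfolding det_mat_leibniz .
    have "pairprod {..<n} (\<lambda>i j. \<bar>q ^ k j - q ^ k i\<bar> ^ 2) = ?V * ?V"
      unfolding pairprod_mult[symmetric] by (simp add: power2_eq_square)
    then have "pairprod {..<n} (\<lambda>i j. \<bar>q ^ k j - q ^ k i\<bar> ^ 2) * ?W * ?c = ?W * (?V * (?V * ?c))"
      by (simp only: mult_ac)
    also have "\<dots> = (\<Sum>p\<in>?S. \<Sum>p'\<in>?S. ?W * (signof p * (\<Prod>i<n. (q ^ k i) ^ p i) * (signof p' * (\<Prod>i<n. poly (P (p' i)) (q ^ k i)))))"
      unfolding V2 unfolding V1 unfolding sum_product unfolding sum_distrib_left ..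
    also have "\<dots> = (\<Sum>p\<in>?S. \<Sum>p'\<in>?S. ?t p p' k)"
    proof (intro sum.cong refl)
      fix p p' :: "nat \<Rightarrow> nat"
      have "(\<Prod>i<n. ?F p p' i (k i)) = ?W * (\<Prod>i<n. (q ^ k i) ^ p i) * (\<Prod>i<n. poly (P (p' i)) (q ^ k i))"
        unfolding prod.distrib[symmetric] polyP[symmetric]
        by (rule prod.cong) (auto simp: y_def power_add power_mult[symmetric] algebra_simps)
      then show "?W * (signof p * (\<Prod>i<n. (q ^ k i) ^ p i) * (signof p' * (\<Prod>i<n. poly (P (p' i)) (q ^ k i)))) = ?t p p' k"
        by (simp only: mult_ac)
    qed
    finally show ?thesis .
  qed
  have F0: "0 \<le> ?F p p' i a" "?F p p' i a \<le> y (p i) ^ a" for p p' i a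
  proof -
    have "0 \<le> qpoch q (q ^ Suc a) (s + p' i)" "qpoch q (q ^ Suc a) (s + p' i) \<le> 1"
      using q power_le_one[of q "Suc a"] by (auto intro!: qpoch_bounds simp del: power_Suc)
    then show "0 \<le> ?F p p' i a" "?F p p' i a \<le> y (p i) ^ a"
      using y by (auto simp: mult_left_le)
  qed
  have sum: "?t p p' summable_on ({..<n} \<rightarrow>\<^sub>E UNIV)" for p p'
  proof (rule summable_on_PiE_bounded)
    show "\<bar>?t p p' k\<bar> \<le> (\<Prod>i<n. y (p i) ^ k i)" for k
    proof -
      have "0 \<le> (\<Prod>i<n. ?F p p' i (k i))"
        by (rule prod_nonneg) (rule F0(1)[of p _ _ p'])
      then have "\<bar>?t p p' k\<bar> = (\<Prod>i<n. ?F p p' i (k i))"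
        by (simp add: abs_mult sign_def del: power_Suc)
      also have "\<dots> \<le> (\<Prod>i<n. y (p i) ^ k i)"
        by (rule prod_mono) (rule conjI, rule F0(1)[of p _ _ p'], rule F0(2)[of p _ _ p'])
      finally show ?thesis .
    qed
  qed (use y in auto)
  have int: "infsum (?t p p') ({..<n} \<rightarrow>\<^sub>E UNIV) = signof p * (signof p' * (\<Prod>i<n. ?M (p i) (p' i)))" for p p'
  proof -
    \<comment> \<open>For fixed \<open>p\<close> and \<open>p'\<close> each factor depends on a
      single \<open>k i\<close>, so the series splits into one-variable q-beta sums.\<close>
    have "infsum (\<lambda>k. \<Prod>i<n. ?F p p' i (k i)) ({..<n} \<rightarrow>\<^sub>E UNIV) = (\<Prod>i<n. infsum (?F p p' i) UNIV)"
    proof (rule infsum_prod_PiE_abs)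
      fix i
      show "(\<lambda>a. norm (?F p p' i a)) summable_on UNIV"
        using F0(1)[of p i _ p'] summable_power_qpoch[OF q y, of "p i" "s + p' i"] by simp
    qed simp
    also have "\<dots> = (\<Prod>i<n. ?M (p i) (p' i))"
      using infsum_power_qpoch[OF q y] by simp
    finally show ?thesis by (simp only: infsum_cmult_right' mult.assoc)
  qed
  let ?I = "pair_sum (\<lambda>a b. \<bar>q ^ b - q ^ a\<bar> ^ 2) (\<lambda>a. q ^ ((r + 1) * a) * qpoch q (q ^ Suc a) s) {..<n}"
  have "?I * ?c = infsum (\<lambda>k. \<Sum>p\<in>?S. \<Sum>p'\<in>?S. ?t p p' k) ({..<n} \<rightarrow>\<^sub>E UNIV)"
    unfolding pair_sum_def infsum_cmult_left'[symmetric] expand ..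
  also have "\<dots> = infsum (\<lambda>k. \<Sum>(p, p')\<in>?S \<times> ?S. ?t p p' k) ({..<n} \<rightarrow>\<^sub>E UNIV)"
    by (simp only: sum.cartesian_product)
  also have "\<dots> = (\<Sum>(p, p')\<in>?S \<times> ?S. infsum (?t p p') ({..<n} \<rightarrow>\<^sub>E UNIV))"
    unfolding case_prod_unfold
    by (rule infsum_finite_sum) (use sum in \<open>auto simp: finite_permutations\<close>)
  also have "\<dots> = (\<Sum>p\<in>?S. signof p * (\<Sum>p'\<in>?S. signof p' * (\<Prod>i<n. ?M (p i) (p' i))))"
    unfolding int by (simp only: sum.cartesian_product[symmetric] sum_distrib_left)
  also have "\<dots> = (\<Sum>p\<in>?S. det (mat n n (\<lambda>(i, j). ?M i j)))"
  proof (rule sum.cong[OF refl])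
    fix p assume "p \<in> ?S"
    \<comment> \<open>For fixed \<open>p\<close> the sum over \<open>p'\<close> is the determinant
      with rows permuted by \<open>p\<close>; its sign cancels the outer
      \<open>signof p\<close>.\<close>
    then have "(\<Sum>p'\<in>?S. signof p' * (\<Prod>i<n. ?M (p i) (p' i))) = signof p * det (mat n n (\<lambda>(i, j). ?M i j))"
      unfolding det_mat_leibniz[of n "\<lambda>i j. ?M (p i) j", symmetric]
      by (intro det_permute_rows_fun) simp
    then show "signof p * (\<Sum>p'\<in>?S. signof p' * (\<Prod>i<n. ?M (p i) (p' i))) = det (mat n n (\<lambda>(i, j). ?M i j))"
      by (simp add: sign_def)
  qed
  also have "\<dots> = fact n * det (mat n n (\<lambda>(i, j). ?M i j))"
    by (simp add: card_permutations)
  finally show ?thesis unfolding y_def .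
qed

section \<open>Evaluation in q-numbers\<close>

lemma one_minus_power_eq_qnum: "q \<noteq> 1 \<Longrightarrow> 1 - q ^ a = (1 - q) * qnum q a"
  by (simp add: qnum_def)

lemma qpoch_power_eq_qnum:
  assumes "q \<noteq> 1"
  shows "qpoch q (q ^ a) m = (1 - q) ^ m * (\<Prod>i<m. qnum q (a + i))"
  unfolding qpoch_def
  by (simp add: power_add[symmetric] one_minus_power_eq_qnum[OF assms] prod.distrib)

lemma qpoch_eq_qfact:
  assumes "q \<noteq> 1"
  shows "qpoch q q m = (1 - q) ^ m * qfact q m"
  using qpoch_power_eq_qnum[OF assms, of 1 m] prod.atLeast1_atMost_eq[of "qnum q" m]
  by (simp add: qfact_def)

section \<open>Bookkeeping of binomial exponents\<close>

lemma choose_Suc_2: "Suc n choose 2 = (n choose 2) + n"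
  by (simp add: numeral_2_eq_2)

lemma choose_Suc_3: "Suc n choose 3 = (n choose 3) + (n choose 2)"
  by (simp add: numeral_3_eq_3 numeral_2_eq_2)

lemma choose_2_add_choose_2: "(n choose 2) + (n choose 2) + n = n * n"
  by (induction n) (simp_all add: choose_Suc_2 binomial_eq_0)

lemma prod_power_choose_2: "(\<Prod>j<n. (t::real) ^ j) = t ^ (n choose 2)"
  by (induction n) (simp_all add: choose_Suc_2 power_add binomial_eq_0)

text \<open>Passing from \<open>n\<close> to \<open>n + 1\<close> adds \<open>j\<close> to each
  summand, that is \<open>n choose 2\<close> in total. The sum supplies the second
  \<open>n choose 3\<close> in the exponent of the third formula.\<close>

lemma sum_index_complement: "(\<Sum>j<n. (n - 1 - j) * j) = n choose 3"
proof (induction n)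
  case (Suc n)
  have "(\<Sum>j<Suc n. (Suc n - 1 - j) * j) = (\<Sum>j<n. (n - 1 - j) * j + j)"
  proof -
    have "(n - j) * j = (n - 1 - j) * j + j" if "j < n" for j
    proof -
      from that obtain d where "n = Suc (j + d)" using less_imp_Suc_add by blast
      then show ?thesis by simp
    qed
    then show ?thesis by simp
  qed
  also have "\<dots> = (n choose 3) + (\<Sum>j<n. j)"
    by (simp only: sum.distrib Suc.IH)
  also have "(\<Sum>j<n. j) = n choose 2"
    by (induction n) (simp_all add: choose_Suc_2 binomial_eq_0)
  finally show ?case by (simp add: choose_Suc_3)
qed (simp add: binomial_eq_0)

text \<open>For fixed \<open>j\<close>, pulling \<open>q ^ (r + 1 + i)\<close> out of each
  difference leaves the factors \<open>1 - q ^ (j - i)\<close>, which in reverse order form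
  \<open>qpoch q q j\<close>.\<close>

lemma pairprod_power_diff:
  fixes q :: real
  shows "pairprod {..<n} (\<lambda>i j. q ^ (r + 1 + i) - q ^ (r + 1 + j)) =
    q ^ ((r + 1) * (n choose 2) + (n choose 3)) * (\<Prod>j<n. qpoch q q j)"
proof -
  have inner: "(\<Prod>i<j. q ^ (r + 1 + i) - q ^ (r + 1 + j)) = q ^ ((r + 1) * j + (j choose 2)) * qpoch q q j" for j
  proof -
    have "(\<Prod>i<j. q ^ (r + 1 + i) - q ^ (r + 1 + j)) = (\<Prod>i<j. q ^ (r + 1 + i) * (1 - q * q ^ (j - Suc i)))"
    proof (rule prod.cong[OF refl])
      fix i assume "i \<in> {..<j}"
      then have "r + 1 + j = (r + 1 + i) + Suc (j - Suc i)" by simp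
      then have "q ^ (r + 1 + j) = q ^ (r + 1 + i) * (q * q ^ (j - Suc i))"
        by (metis power_add power_Suc)
      then show "q ^ (r + 1 + i) - q ^ (r + 1 + j) = q ^ (r + 1 + i) * (1 - q * q ^ (j - Suc i))"
        by (simp only: right_diff_distrib mult_1_right)
    qed
    also have "\<dots> = (\<Prod>i<j. q ^ (r + 1 + i)) * qpoch q q j"
      unfolding prod.distrib qpoch_def prod.nat_diff_reindex[of "\<lambda>i. 1 - q * q ^ i" j] ..
    also have "(\<Prod>i<j. q ^ (r + 1 + i)) = q ^ ((r + 1) * j + (j choose 2))"
      by (induction j) (simp_all add: choose_Suc_2 power_add binomial_eq_0 mult_ac)
    finally show ?thesis .
  qed
  have "(\<Prod>j<n. q ^ ((r + 1) * j + (j choose 2))) = q ^ ((r + 1) * (n choose 2) + (n choose 3))"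
  proof (induction n)
    case (Suc n)
    then show ?case by (simp add: choose_Suc_2 choose_Suc_3 power_add[symmetric] algebra_simps del: power_Suc)
  qed (simp add: binomial_eq_0)
  then show ?thesis
    unfolding prod_pairs_less[symmetric] inner prod.distrib by simp
qed

section \<open>From Jackson integrals to sums over exponents\<close>

lemma prod_prod_greater_eq_pairprod: "(\<Prod>i=1..n. \<Prod>j\<in>{i<..n}. g i j) = pairprod {1..n} g"
proof -
  have "pairprod {1..n} g = (\<Prod>(i, j)\<in>(SIGMA i:{1..n}. {i<..n}). g i j)"
    unfolding pairprod_def by (rule prod.cong) auto
  then show ?thesis by (simp add: prod.Sigma)
qed

lemma pairprod_atLeastAtMost:
  assumes "\<And>i j. g i j = g j i"
  shows "pairprod {1..n} g = pairprod {..<n} (\<lambda>i j. g (Suc i) (Suc j))"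
  by (rule pairprod_bij[symmetric, of Suc])
    (use assms in \<open>auto simp: bij_betw_def image_Suc_lessThan\<close>)

text \<open>The factor \<open>q ^ a\<close> in the weight is the share of one variable in the
  Jackson measure. The indices move from \<open>{1..n}\<close> to \<open>{..<n}\<close> to match
  matrix indices.\<close>

lemma jackson_integral_eq_pair_sum:
  assumes "\<And>a b. G a b = G b a"
  shows "jackson_integral q n (\<lambda>x. (\<Prod>i=1..n. u (x i)) * (\<Prod>i=1..n. \<Prod>j\<in>{i<..n}. G (x j) (x i))) =
    (1 - q) ^ n * pair_sum (\<lambda>a b. G (q ^ b) (q ^ a)) (\<lambda>a. u (q ^ a) * q ^ a) {..<n}"
proof -
  have "jackson_integral q n (\<lambda>x. (\<Prod>i=1..n. u (x i)) * (\<Prod>i=1..n. \<Prod>j\<in>{i<..n}. G (x j) (x i))) =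
      (1 - q) ^ n * pair_sum (\<lambda>a b. G (q ^ b) (q ^ a)) (\<lambda>a. u (q ^ a) * q ^ a) {1..n}"
    unfolding jackson_integral_def pair_sum_def prod_prod_greater_eq_pairprod
    by (simp add: power_sum prod.distrib mult_ac)
  also have "pair_sum (\<lambda>a b. G (q ^ b) (q ^ a)) (\<lambda>a. u (q ^ a) * q ^ a) {1..n} =
      pair_sum (\<lambda>a b. G (q ^ b) (q ^ a)) (\<lambda>a. u (q ^ a) * q ^ a) {..<n}"
    by (rule pair_sum_eq_if_card_eq) (use assms in auto)
  finally show ?thesis .
qed

lemma prod_qfact_lessThan: "(\<Prod>j<n. qfact q j) = (\<Prod>i=1..<n. qfact q i)"
proof -
  have "qfact q 0 = 1" by (simp add: qfact_def)
  then show ?thesis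
    by (intro prod.mono_neutral_right) (auto simp: Suc_le_eq)
qed

section \<open>Closed forms of the three sums\<close>

lemma pair_sum_abs_diff_eval:
  fixes q :: real
  assumes q: "0 < q" "q < 1"
  shows "(1 - q) ^ n * pair_sum (\<lambda>a b. \<bar>q ^ b - q ^ a\<bar>) (\<lambda>a. q ^ ((r + 1) * a)) {..<n} =
    fact n * q ^ ((r + 1) * (n choose 2) + (n choose 3)) *
       ((\<Prod>i=1..<n. qfact q i)
        / ((\<Prod>i=1..n. qnum q (r + i)) *
           (\<Prod>i=1..n. \<Prod>j\<in>{i<..n}. qnum q (2 * r + i + j))))"
proof -
  let ?Q = "\<Prod>i=1..n. qnum q (r + i)"
  let ?R = "pairprod {1..n} (\<lambda>i j. qnum q (2 * r + i + j))"
  have q1: "q \<noteq> 1" "1 - q \<noteq> 0" using q by auto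
  have 1: "(\<Prod>i<n. 1 / (1 - q ^ (r + 1 + i))) = 1 / ((1 - q) ^ n * ?Q)"
    unfolding one_minus_power_eq_qnum[OF q1(1)] prod_dividef prod.distrib
    using prod.atLeast1_atMost_eq[of "\<lambda>i. qnum q (r + i)" n] by simp
  have "?R = pairprod {..<n} (\<lambda>i j. qnum q (2 * r + Suc i + Suc j))"
    by (rule pairprod_atLeastAtMost) (simp add: add_ac)
  moreover have "pairprod {..<n} (\<lambda>i j. 1 - q ^ (r + 1 + i) * q ^ (r + 1 + j)) =
      pairprod {..<n} (\<lambda>i j. (1 - q) * qnum q (2 * r + Suc i + Suc j))"
  proof (rule pairprod_cong)
    fix i j
    have "(r + 1 + i) + (r + 1 + j) = 2 * r + Suc i + Suc j" by simp
    then show "1 - q ^ (r + 1 + i) * q ^ (r + 1 + j) = (1 - q) * qnum q (2 * r + Suc i + Suc j)"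
      by (simp only: power_add[symmetric] one_minus_power_eq_qnum[OF q1(1)])
  qed
  ultimately have 2: "pairprod {..<n} (\<lambda>i j. 1 - q ^ (r + 1 + i) * q ^ (r + 1 + j)) = (1 - q) ^ (n choose 2) * ?R"
    by (simp add: pairprod_mult pairprod_const)
  have 3: "(\<Prod>j<n. qpoch q q j) = (1 - q) ^ (n choose 2) * (\<Prod>i=1..<n. qfact q i)"
    unfolding qpoch_eq_qfact[OF q1(1)] prod.distrib prod_power_choose_2 prod_qfact_lessThan ..
  \<comment> \<open>The powers of \<open>1 - q\<close> cancel: exponent \<open>n\<close> against the
    linear denominators, exponent \<open>n choose 2\<close> between the numerators and denominators
    of the pairs.\<close>
  show ?thesis
    unfolding pair_sum_abs_diff[OF q] pairprod_divide pairprod_power_diff 1 2 3 prod_prod_greater_eq_pairprod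
    using q1 by simp
qed

text \<open>The relation from removing the minimum is solved for the sum in \<open>n\<close>
  variables, with the first closed form inserted for \<open>n + 1\<close> variables. Its factor
  \<open>1 - q ^ ?E\<close> becomes the additional q-number in the numerator.\<close>

lemma pair_sum_abs_diff_qshift_eval:
  fixes q :: real
  assumes q: "0 < q" "q < 1"
  shows "(1 - q) ^ n * pair_sum (\<lambda>a b. \<bar>q ^ b - q ^ a\<bar>) (\<lambda>a. (1 - q * q ^ a) * q ^ ((r + 1) * a)) {..<n} =
    fact n * q ^ ((r + 1) * (n choose 2) + (n choose 3)) *
       ((\<Prod>i=1..n. qfact q i) * qnum q ((n + 1) * r + ((n + 2) choose 2))
        / ((\<Prod>i=1..n + 1. qnum q (r + i)) *
           (\<Prod>i=1..n + 1. \<Prod>j\<in>{i<..n + 1}. qnum q (2 * r + i + j))))"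
proof -
  let ?S = "pair_sum (\<lambda>a b. \<bar>q ^ b - q ^ a\<bar>) (\<lambda>a. (1 - q * q ^ a) * q ^ ((r + 1) * a)) {..<n}"
  let ?S' = "pair_sum (\<lambda>a b. \<bar>q ^ b - q ^ a\<bar>) (\<lambda>a. q ^ ((r + 1) * a)) {..<Suc n}"
  let ?E = "(n + 1) * r + ((n + 2) choose 2)"
  let ?d = "(r + 1) * n + (n choose 2)"
  let ?D = "(r + 1) * (n choose 2) + (n choose 3)"
  let ?N = "\<Prod>i=1..n. qfact q i"
  let ?M = "(\<Prod>i=1..n + 1. qnum q (r + i)) * (\<Prod>i=1..n + 1. \<Prod>j\<in>{i<..n + 1}. qnum q (2 * r + i + j))"
  have E: "(n + 1) * (r + 1) + (Suc n choose 2) = ?E"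
    using choose_Suc_2[of "Suc n"] by simp
  have D: "(r + 1) * (Suc n choose 2) + (Suc n choose 3) = ?D + ?d"
    unfolding choose_Suc_2 choose_Suc_3 by (simp add: algebra_simps)
  have N: "{1..<Suc n} = {1..n}" by auto
  have S': "(1 - q) ^ Suc n * ?S' = fact (Suc n) * q ^ (?D + ?d) * (?N / ?M)"
    using pair_sum_abs_diff_eval[OF q, of "Suc n" r] unfolding D N by simp
  have key: "?S' * ((1 - q) * qnum q ?E) = real (Suc n) * q ^ ?d * ?S"
    using pair_sum_abs_diff_remove_min[OF q, of r n] unfolding E using q one_minus_power_eq_qnum[of q ?E] by simp
  have "(real (Suc n) * q ^ ?d) * ((1 - q) ^ n * ?S) = (1 - q) ^ n * (?S' * ((1 - q) * qnum q ?E))"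
    unfolding key by (simp only: mult_ac)
  also have "\<dots> = ((1 - q) ^ Suc n * ?S') * qnum q ?E"
    by (simp only: power_Suc mult_ac)
  also have "\<dots> = (real (Suc n) * q ^ ?d) * (fact n * q ^ ?D * (?N * qnum q ?E / ?M))"
    unfolding S' fact_Suc power_add by (simp only: mult_ac times_divide_eq_right times_divide_eq_left of_nat_mult)
  finally show ?thesis
    using q by (subst (asm) mult_cancel_left) auto
qed

lemma pair_sum_diff_square_eval:
  fixes q :: real
  assumes q: "0 < q" "q < 1"
  shows "(1 - q) ^ n * pair_sum (\<lambda>a b. \<bar>q ^ b - q ^ a\<bar> ^ 2) (\<lambda>a. q ^ ((r + 1) * a) * qpoch q (q ^ Suc a) s) {..<n} =
    fact n * q ^ ((r + 1) * (n choose 2) + 2 * (n choose 3)) *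
       ((\<Prod>i=1..<n. qfact q i) * (\<Prod>i=0..<n. qfact q (s + i))
        / (\<Prod>i=1..n + s. \<Prod>j=1..n. qnum q (r + i + j - 1)))"
proof -
  let ?I = "pair_sum (\<lambda>a b. \<bar>q ^ b - q ^ a\<bar> ^ 2) (\<lambda>a. q ^ ((r + 1) * a) * qpoch q (q ^ Suc a) s) {..<n}"
  let ?c = "\<Prod>j<n. \<Prod>i<j. - (q ^ (s + 1 + i))"
  let ?R = "\<Prod>i=1..n + s. \<Prod>j=1..n. qnum q (r + i + j - 1)"
  let ?F = "\<Prod>i=1..<n. qfact q i" and ?G = "\<Prod>i=0..<n. qfact q (s + i)"
  let ?D = "(r + 1) * (n choose 2) + (n choose 3)"
  have q1: "q \<noteq> 1" "1 - q \<noteq> 0" using q by auto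
  have c: "?c \<noteq> 0" using q by simp
  have 1: "(\<Prod>j<n. qpoch q q (s + j)) = (1 - q) ^ (s * n + (n choose 2)) * ?G"
    unfolding qpoch_eq_qfact[OF q1(1)] prod.distrib power_add prod_power_choose_2
    by (simp add: lessThan_atLeast0 power_mult)
  \<comment> \<open>In column \<open>j\<close> each of the \<open>j\<close> exponents exceeds the
    corresponding one in \<open>?c\<close> by \<open>n - 1 - j\<close>; the total excess is
    \<open>n choose 3\<close>.\<close>
  have 2: "(\<Prod>j<n. \<Prod>i<j. - (q ^ (s + n - j + i))) = ?c * q ^ (n choose 3)"
  proof -
    have "(\<Prod>j<n. \<Prod>i<j. - (q ^ (s + n - j + i))) = (\<Prod>j<n. (\<Prod>i<j. - (q ^ (s + 1 + i))) * q ^ ((n - 1 - j) * j))"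
    proof (rule prod.cong[OF refl])
      fix j assume "j \<in> {..<n}"
      then have "s + n - j + i = (s + 1 + i) + (n - 1 - j)" for i by simp
      then have "(\<Prod>i<j. - (q ^ (s + n - j + i))) = (\<Prod>i<j. - (q ^ (s + 1 + i)) * q ^ (n - 1 - j))"
        by (simp only: power_add mult_minus_left)
      then show "(\<Prod>i<j. - (q ^ (s + n - j + i))) = (\<Prod>i<j. - (q ^ (s + 1 + i))) * q ^ ((n - 1 - j) * j)"
        by (simp only: prod.distrib prod_constant card_lessThan power_mult)
    qed
    then show ?thesis
      by (simp only: prod.distrib power_sum[symmetric] sum_index_complement)
  qed
  have 3: "(\<Prod>i<n. qpoch q (q ^ (r + 1 + i)) (s + n)) = (1 - q) ^ ((s + n) * n) * ?R"
  proof -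
    have "?R = (\<Prod>i<n + s. \<Prod>j<n. qnum q (r + 1 + j + i))"
      by (simp add: prod.atLeast1_atMost_eq add_ac)
    also have "\<dots> = (\<Prod>j<n. \<Prod>i<n + s. qnum q (r + 1 + j + i))"
      by (rule prod.swap)
    finally show ?thesis
      unfolding qpoch_power_eq_qnum[OF q1(1)] prod.distrib by (simp add: power_mult add.commute)
  qed
  have 4: "(\<Prod>j<n. qpoch q q j) = (1 - q) ^ (n choose 2) * ?F"
    unfolding qpoch_eq_qfact[OF q1(1)] prod.distrib prod_power_choose_2 prod_qfact_lessThan ..
  \<comment> \<open>The prefactor \<open>(1 - q) ^ n\<close> exactly balances the powers of
    \<open>1 - q\<close> in numerator and denominator.\<close>
  have "n + (s * n + (n choose 2)) + (n choose 2) = (s + n) * n"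
    using choose_2_add_choose_2[of n] by (simp add: algebra_simps)
  then have pw: "(1 - q) ^ n * (1 - q) ^ (s * n + (n choose 2)) * (1 - q) ^ (n choose 2) = (1 - q) ^ ((s + n) * n)"
    by (simp only: power_add[symmetric])
  have "?I * ?c = fact n * ((1 - q) ^ (s * n + (n choose 2)) * ?G * (?c * q ^ (n choose 3)) /
      ((1 - q) ^ ((s + n) * n) * ?R) * (q ^ ?D * ((1 - q) ^ (n choose 2) * ?F)))"
    unfolding pair_sum_diff_square[OF q] det_qbeta[OF q] pairprod_power_diff 1 2 3 4 ..
  also have "\<dots> = fact n * ((1 - q) ^ (s * n + (n choose 2)) * ?G * q ^ (n choose 3) /
      ((1 - q) ^ ((s + n) * n) * ?R) * (q ^ ?D * ((1 - q) ^ (n choose 2) * ?F))) * ?c"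
    by (simp only: mult_ac times_divide_eq_right times_divide_eq_left)
  finally have "?I = fact n * ((1 - q) ^ (s * n + (n choose 2)) * ?G * q ^ (n choose 3) /
      ((1 - q) ^ ((s + n) * n) * ?R) * (q ^ ?D * ((1 - q) ^ (n choose 2) * ?F)))"
    unfolding mult_right_cancel[OF c] .
  then have "(1 - q) ^ n * ?I = fact n * (q ^ ?D * q ^ (n choose 3)) * (((1 - q) ^ n * (1 - q) ^ (s * n + (n choose 2)) * (1 - q) ^ (n choose 2)) * (?F * ?G) /
      ((1 - q) ^ ((s + n) * n) * ?R))"
    by (simp only: mult_ac times_divide_eq_right times_divide_eq_left)
  also have "q ^ ?D * q ^ (n choose 3) = q ^ ((r + 1) * (n choose 2) + 2 * (n choose 3))"
    by (simp add: power_add[symmetric] mult_2 add.assoc)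
  finally show ?thesis unfolding pw using q1 by simp
qed

lemma qx_poch_eq_qpoch: "qx_poch q x s = qpoch q (q * x) s"
  by (simp add: qx_poch_def qpoch_def prod.atLeast1_atMost_eq mult_ac)

(* Two misprints of the source, which make its second and third formulas false already for
   n = 1, are corrected here: the last q-number in the numerator of the second formula has
   (n + 2 choose 2) instead of (n + 1 choose 2), and the product of the factorials of
   s + i in the third formula starts at i = 0 instead of i = 1. *)
theorem theorem4p1:
  fixes n r s :: nat and q :: real
  assumes "n \<ge> 1" and "0 < q" and "q < 1"
  shows
    "jackson_integral q n
       (\<lambda>x. (\<Prod>i=1..n. x i ^ r) * (\<Prod>i=1..n. \<Prod>j\<in>{i<..n}. \<bar>x j - x i\<bar>))
     = fact n * q ^ ((r + 1) * (n choose 2) + (n choose 3)) *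
       ((\<Prod>i=1..<n. qfact q i)
        / ((\<Prod>i=1..n. qnum q (r + i)) *
           (\<Prod>i=1..n. \<Prod>j\<in>{i<..n}. qnum q (2 * r + i + j))))
   \<and> jackson_integral q n
       (\<lambda>x. (\<Prod>i=1..n. x i ^ r * (1 - q * x i)) * (\<Prod>i=1..n. \<Prod>j\<in>{i<..n}. \<bar>x j - x i\<bar>))
     = fact n * q ^ ((r + 1) * (n choose 2) + (n choose 3)) *
       ((\<Prod>i=1..n. qfact q i) * qnum q ((n + 1) * r + ((n + 2) choose 2))
        / ((\<Prod>i=1..n + 1. qnum q (r + i)) *
           (\<Prod>i=1..n + 1. \<Prod>j\<in>{i<..n + 1}. qnum q (2 * r + i + j))))
   \<and> jackson_integral q n
       (\<lambda>x. (\<Prod>i=1..n. x i ^ r * qx_poch q (x i) s) *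
            (\<Prod>i=1..n. \<Prod>j\<in>{i<..n}. \<bar>x j - x i\<bar> ^ 2))
     = fact n * q ^ ((r + 1) * (n choose 2) + 2 * (n choose 3)) *
       ((\<Prod>i=1..<n. qfact q i) * (\<Prod>i=0..<n. qfact q (s + i))
        / (\<Prod>i=1..n + s. \<Prod>j=1..n. qnum q (r + i + j - 1)))"

proof (intro conjI)
  note q = assms(2,3)
  have w: "(q ^ a) ^ r * q ^ a = q ^ ((r + 1) * a)" for a
    by (simp add: power_mult[symmetric] power_add mult.commute)
  show "jackson_integral q n
       (\<lambda>x. (\<Prod>i=1..n. x i ^ r) * (\<Prod>i=1..n. \<Prod>j\<in>{i<..n}. \<bar>x j - x i\<bar>))
     = fact n * q ^ ((r + 1) * (n choose 2) + (n choose 3)) *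
       ((\<Prod>i=1..<n. qfact q i)
        / ((\<Prod>i=1..n. qnum q (r + i)) *
           (\<Prod>i=1..n. \<Prod>j\<in>{i<..n}. qnum q (2 * r + i + j))))"
    using jackson_integral_eq_pair_sum[of "\<lambda>a b. \<bar>a - b\<bar>" q n "\<lambda>x. x ^ r"]
    unfolding w pair_sum_abs_diff_eval[OF q] by (simp only: abs_minus_commute)
  have w': "((q ^ a) ^ r * (1 - q * q ^ a)) * q ^ a = (1 - q * q ^ a) * q ^ ((r + 1) * a)" for a
    unfolding w[symmetric] by (simp only: mult_ac)
  show "jackson_integral q n
       (\<lambda>x. (\<Prod>i=1..n. x i ^ r * (1 - q * x i)) * (\<Prod>i=1..n. \<Prod>j\<in>{i<..n}. \<bar>x j - x i\<bar>))
     = fact n * q ^ ((r + 1) * (n choose 2) + (n choose 3)) *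
       ((\<Prod>i=1..n. qfact q i) * qnum q ((n + 1) * r + ((n + 2) choose 2))
        / ((\<Prod>i=1..n + 1. qnum q (r + i)) *
           (\<Prod>i=1..n + 1. \<Prod>j\<in>{i<..n + 1}. qnum q (2 * r + i + j))))"
    using jackson_integral_eq_pair_sum[of "\<lambda>a b. \<bar>a - b\<bar>" q n "\<lambda>x. x ^ r * (1 - q * x)"]
    unfolding w' pair_sum_abs_diff_qshift_eval[OF q] by (simp only: abs_minus_commute)
  have w'': "((q ^ a) ^ r * qx_poch q (q ^ a) s) * q ^ a = q ^ ((r + 1) * a) * qpoch q (q ^ Suc a) s" for a
    unfolding w[symmetric] qx_poch_eq_qpoch power_Suc by (simp only: mult_ac)
  show "jackson_integral q n
       (\<lambda>x. (\<Prod>i=1..n. x i ^ r * qx_poch q (x i) s) *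
            (\<Prod>i=1..n. \<Prod>j\<in>{i<..n}. \<bar>x j - x i\<bar> ^ 2))
     = fact n * q ^ ((r + 1) * (n choose 2) + 2 * (n choose 3)) *
       ((\<Prod>i=1..<n. qfact q i) * (\<Prod>i=0..<n. qfact q (s + i))
        / (\<Prod>i=1..n + s. \<Prod>j=1..n. qnum q (r + i + j - 1)))"
    using jackson_integral_eq_pair_sum[of "\<lambda>a b. \<bar>a - b\<bar> ^ 2" q n "\<lambda>x. x ^ r * qx_poch q x s"]
    unfolding w'' pair_sum_diff_square_eval[OF q] by (simp only: abs_minus_commute)
qed

end
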